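(* Let $(\mathcal{B},\mathcal{B}^\diamond)$ be an integral vv-RKBS pair, built from locally compact Hausdorff spaces $X,\Omega$, a function $\phi\in C_0(X\times\Omega)$ and a continuous dual pair $(\mathcal{U},\mathcal{U}^\diamond)$ of Banach spaces. Then $(\mathcal{B},\mathcal{B}^\diamond)$ is an adjoint pair of vv-RKBSs. In particular, if $C>0$ is the smallest constant such that the continuous pairing $\langle\cdot,\cdot\rangle_{\mathcal{U}}$ satisfies $|\langle u^\diamond,u\rangle_{\mathcal{U}}|\le C\|u^\diamond\|_{\mathcal{U}^\diamond}\|u\|_{\mathcal{U}}$ for all $(u,u^\diamond)\in\mathcal{U}\times\mathcal{U}^\diamond$, then the pairing $\langle\cdot,\cdot\rangle_{\mathcal{B}}$ is continuous with the bound $$|\langle g,f\rangle_{\mathcal{B}}|\le C\,\|g\|_{\mathcal{B}^\diamond}\|f\|_{\mathcal{B}}$$ for all $(f,g)\in\mathcal{B}\times\mathcal{B}^\diamond$.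
   Context: All vector spaces are real. vv-RKBS: a Banach space $\mathcal{B}$ of functions from a set $X$ to a Banach space $\mathcal{U}$ such that for every $x\in X$ there is $C_x\ge0$ with $\|f(x)\|_{\mathcal{U}}\le C_x\|f\|_{\mathcal{B}}$ for all $f\in\mathcal{B}$. Dual pair: a dual pair of Banach spaces $(E,E^\diamond)$ consists of two Banach spaces and a bilinear map $\langle\cdot,\cdot\rangle_E\colon E^\diamond\times E\to\mathbb{R}$ (the duality pairing) such that $\langle g,f\rangle_E=0$ for all $g\in E^\diamond$ implies $f=0$, and $\langle g,f\rangle_E=0$ for all $f\in E$ implies $g=0$. It is continuous if this bilinear map is continuous. Twin operators: for a dual pair $(\mathcal{U},\mathcal{U}^\diamond)$, $\mathrm{Twin}(\mathcal{U},\mathcal{U}^\diamond)$ is the space of bounded bilinear maps $T\colon\mathcal{U}^\diamond\times\mathcal{U}\to\mathbb{R}$ for which there are linear operators $T_{\mathcal{U}}\colon\mathcal{U}\to\mathcal{U}$ and $T_{\mathcal{U}^\diamond}\colon\mathcal{U}^\diamond\to\mathcal{U}^\diamond$ with $\langle u^\diamond,T_{\mathcal{U}}u\rangle_{\mathcal{U}}=T(u^\diamond,u)=\langle T_{\mathcal{U}^\diamond}u^\diamond,u\rangle_{\mathcal{U}}$ for all $u^\diamond,u$. For $K\colon X\times\Omega\to\mathrm{Twin}(\mathcal{U},\mathcal{U}^\diamond)$, $K_{\mathcal{U}}(x,w),K_{\mathcal{U}^\diamond}(x,w)$ denote the operators associated with $K(x,w)$. Adjoint pair of vv-RKBSs: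 $\mathcal{B}$ a vv-RKBS of functions $X\to\mathcal{U}$, $\mathcal{B}^\diamond$ a vv-RKBS of functions $\Omega\to\mathcal{U}^\diamond$, with a continuous duality pairing $\langle\cdot,\cdot\rangle_{\mathcal{B}}\colon\mathcal{B}^\diamond\times\mathcal{B}\to\mathbb{R}$ and a kernel $K\colon X\times\Omega\to\mathrm{Twin}(\mathcal{U},\mathcal{U}^\diamond)$ such that (i) $K_{\mathcal{U}^\diamond}(x,\cdot)u^\diamond\in\mathcal{B}^\diamond$ and $\langle u^\diamond,f(x)\rangle_{\mathcal{U}}=\langle K_{\mathcal{U}^\diamond}(x,\cdot)u^\diamond,f\rangle_{\mathcal{B}}$ for all $x\in X$, $u^\diamond\in\mathcal{U}^\diamond$, $f\in\mathcal{B}$; and (ii) $K_{\mathcal{U}}(\cdot,w)u\in\mathcal{B}$ and $\langle g(w),u\rangle_{\mathcal{U}}=\langle g,K_{\mathcal{U}}(\cdot,w)u\rangle_{\mathcal{B}}$ for all $w\in\Omega$, $u\in\mathcal{U}$, $g\in\mathcal{B}^\diamond$. Measures: for a Banach space $V$ and a locally compact Hausdorff space $\Omega$, $\mathcal{M}(\Omega;V)$ is the space of regular countably additive $V$-valued Borel vector measures $\mu$ of finite total variation; $|\mu|_V$ is the total variation measure. $C_0(\cdot)$ denotes continuous real functions vanishing at infinity. Pairing with measures: for $\mu\in\mathcal{M}(\Omega;\mathcal{U})$ and a simple function $g=\sum_{j=1}^m u_j^\diamond\mathbf{1}_{B_j}$ ($B_j\subseteq\Omega$ disjoint Borel sets,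 $u_j^\diamond\in\mathcal{U}^\diamond$) put $\langle\mu,g\rangle_{C_0(\Omega;\mathcal{U}^\diamond)}:=\sum_j\langle u_j^\diamond,\mu(B_j)\rangle_{\mathcal{U}}$, extended continuously (in supremum norm) to all uniform limits of simple functions. Integral vv-RKBS pair: for $\mu\in\mathcal{M}(\Omega;\mathcal{U})$ and $\rho\in\mathcal{M}(X;\mathcal{U}^\diamond)$ set $(A_{\Omega\to X}\mu)(x)=\int_\Omega\phi(x,w)\,d\mu(w)$ and $(A_{X\to\Omega}\rho)(w)=\int_X\phi(x,w)\,d\rho(x)$. Then $\mathcal{B}:=\{A_{\Omega\to X}\mu\mid\mu\in\mathcal{M}(\Omega;\mathcal{U})\}$ with $\|f\|_{\mathcal{B}}:=\inf_{f=A_{\Omega\to X}\mu}|\mu|_{\mathcal{U}}(\Omega)$; $\mathcal{B}^\diamond$ is the closure of $\mathcal{B}^\diamond_{\mathrm{pre}}:=\{A_{X\to\Omega}\rho\mid\rho\in\mathcal{M}(X;\mathcal{U}^\diamond)\}$ under $\|g\|_{\mathcal{B}^\diamond}:=\sup_{w\in\Omega}\|g(w)\|_{\mathcal{U}^\diamond}$; the pairing is $\langle g,f\rangle_{\mathcal{B}}:=\langle\mu,g\rangle_{C_0(\Omega;\mathcal{U}^\diamond)}$ for any $\mu$ with $f=A_{\Omega\to X}\mu$ (this does not depend on the choice of $\mu$), and for $g=A_{X\to\Omega}\rho\in\mathcal{B}^\diamond_{\mathrm{pre}}$ it equals $\int_{X\times\Omega}\phi\,d\langle\rho,\mu\rangle_{\mathcal{U}}$,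 where $\langle\rho,\mu\rangle_{\mathcal{U}}$ is the finite signed measure with $\langle\rho,\mu\rangle_{\mathcal{U}}(E\times F)=\langle\rho(E),\mu(F)\rangle_{\mathcal{U}}$ for Borel $E\subseteq X$, $F\subseteq\Omega$. The kernel is $K(x,w)(u^\diamond,u)=\phi(x,w)\langle u^\diamond,u\rangle_{\mathcal{U}}$, with $K_{\mathcal{U}}(x,w)u=\phi(x,w)u$ and $K_{\mathcal{U}^\diamond}(x,w)u^\diamond=\phi(x,w)u^\diamond$. *)

theory Defs
  imports "HOL-Analysis.Analysis" "HOL-Library.Function_Algebras"
begin

section \<open>Function spaces as real vector spaces\<close>

text \<open>HOL-Library makes functions into an additive group; this adds pointwise scalar
  multiplication, so that \<^const>\<open>subspace\<close> applies to sets of functions.\<close>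

instantiation "fun" :: (type, real_vector) real_vector
begin

definition scaleR_fun_def: "scaleR c f = (\<lambda>x. c *\<^sub>R f x)"

instance
  by standard (auto simp: scaleR_fun_def fun_eq_iff algebra_simps)

end

lemma scaleR_fun_apply [simp]: "(c *\<^sub>R f) x = c *\<^sub>R f x"
  by (simp add: scaleR_fun_def)


section \<open>Banach spaces on a carrier, and dual pairs\<close>

definition normed_on :: "'a::real_vector set \<Rightarrow> ('a \<Rightarrow> real) \<Rightarrow> bool" where
  "normed_on E N \<longleftrightarrow> subspace E \<and>
     (\<forall>f\<in>E. 0 \<le> N f) \<and>
     (\<forall>f\<in>E. N f = 0 \<longleftrightarrow> f = 0) \<and>
     (\<forall>f\<in>E. \<forall>c. N (c *\<^sub>R f) = \<bar>c\<bar> * N f) \<and>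
     (\<forall>f\<in>E. \<forall>g\<in>E. N (f + g) \<le> N f + N g)"

text \<open>The locale \<^locale>\<open>Metric_space\<close> asks for nonnegativity and symmetry of the distance
  also off the carrier, whence the case distinction.\<close>

definition norm_dist :: "'a::real_vector set \<Rightarrow> ('a \<Rightarrow> real) \<Rightarrow> 'a \<Rightarrow> 'a \<Rightarrow> real" where
  "norm_dist E N f g = (if f \<in> E \<and> g \<in> E then N (f - g) else 0)"

definition norm_topology :: "'a::real_vector set \<Rightarrow> ('a \<Rightarrow> real) \<Rightarrow> 'a topology" where
  "norm_topology E N = Metric_space.mtopology E (norm_dist E N)"

definition banach_on :: "'a::real_vector set \<Rightarrow> ('a \<Rightarrow> real) \<Rightarrow> bool" where
  "banach_on E N \<longleftrightarrow> normed_on E N \<and> Metric_space.mcomplete E (norm_dist E N)"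

lemma Metric_space_norm_dist:
  assumes "normed_on E N"
  shows "Metric_space E (norm_dist E N)"
proof -
  have E: "subspace E"
    and nonneg: "\<And>f. f \<in> E \<Longrightarrow> 0 \<le> N f"
    and zero: "\<And>f. f \<in> E \<Longrightarrow> N f = 0 \<longleftrightarrow> f = 0"
    and scale: "\<And>f c. f \<in> E \<Longrightarrow> N (c *\<^sub>R f) = \<bar>c\<bar> * N f"
    and triangle: "\<And>f g. f \<in> E \<Longrightarrow> g \<in> E \<Longrightarrow> N (f + g) \<le> N f + N g"
    using assms by (simp_all add: normed_on_def)
  note sub = subspace_diff[OF E]
  have comm: "N (f - g) = N (g - f)" if "f \<in> E" "g \<in> E" for f g
    using scale[OF sub[OF that(2,1)], of "-1"] by simp
  have tri: "N (f - h) \<le> N (f - g) + N (g - h)" if "f \<in> E" "g \<in> E" "h \<in> E" for f g h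
    using triangle[OF sub[OF that(1,2)] sub[OF that(2,3)]] by simp
  show ?thesis
  proof
    show "0 \<le> norm_dist E N f g" for f g
      by (simp add: norm_dist_def nonneg sub)
    show "norm_dist E N f g = norm_dist E N g f" for f g
      using comm[of f g] by (simp add: norm_dist_def)
    show "norm_dist E N f g = 0 \<longleftrightarrow> f = g" if "f \<in> E" "g \<in> E" for f g
      using zero[OF sub[OF that]] that by (simp add: norm_dist_def)
    show "norm_dist E N f h \<le> norm_dist E N f g + norm_dist E N g h"
      if "f \<in> E" "g \<in> E" "h \<in> E" for f g h
      using tri[OF that] that by (simp add: norm_dist_def)
  qed
qed

lemma norm_dist_UNIV: "norm_dist UNIV norm = (dist :: 'a::real_normed_vector \<Rightarrow> 'a \<Rightarrow> real)"
  by (simp add: norm_dist_def dist_norm fun_eq_iff)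

lemma norm_topology_UNIV:
  "norm_topology (UNIV :: 'a::real_normed_vector set) norm = euclidean"
  by (simp add: norm_topology_def norm_dist_UNIV)

lemma banach_on_UNIV: "banach_on (UNIV :: 'a::banach set) norm"
  unfolding banach_on_def normed_on_def norm_dist_UNIV
  by (simp add: norm_triangle_ineq complete_UNIV)

definition bilinear_on ::
  "'b::real_vector set \<Rightarrow> 'a::real_vector set \<Rightarrow> ('b \<Rightarrow> 'a \<Rightarrow> real) \<Rightarrow> bool" where
  "bilinear_on F E p \<longleftrightarrow>
     (\<forall>g\<in>F. \<forall>g'\<in>F. \<forall>f\<in>E. p (g + g') f = p g f + p g' f) \<and>
     (\<forall>g\<in>F. \<forall>f\<in>E. \<forall>c. p (c *\<^sub>R g) f = c * p g f) \<and>
     (\<forall>g\<in>F. \<forall>f\<in>E. \<forall>f'\<in>E. p g (f + f') = p g f + p g f') \<and>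
     (\<forall>g\<in>F. \<forall>f\<in>E. \<forall>c. p g (c *\<^sub>R f) = c * p g f)"

text \<open>In a dual pair \<open>(E, E\<^sup>\<diamond>)\<close>, written \<open>(E, F)\<close> here, the pairing takes its argument from
  \<open>E\<^sup>\<diamond>\<close> first.\<close>

definition dual_pair :: "'a::real_vector set \<Rightarrow> ('a \<Rightarrow> real) \<Rightarrow>
    'b::real_vector set \<Rightarrow> ('b \<Rightarrow> real) \<Rightarrow> ('b \<Rightarrow> 'a \<Rightarrow> real) \<Rightarrow> bool" where
  "dual_pair E NE F NF p \<longleftrightarrow> banach_on E NE \<and> banach_on F NF \<and> bilinear_on F E p \<and>
     (\<forall>f\<in>E. (\<forall>g\<in>F. p g f = 0) \<longrightarrow> f = 0) \<and>
     (\<forall>g\<in>F. (\<forall>f\<in>E. p g f = 0) \<longrightarrow> g = 0)"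

definition continuous_dual_pair :: "'a::real_vector set \<Rightarrow> ('a \<Rightarrow> real) \<Rightarrow>
    'b::real_vector set \<Rightarrow> ('b \<Rightarrow> real) \<Rightarrow> ('b \<Rightarrow> 'a \<Rightarrow> real) \<Rightarrow> bool" where
  "continuous_dual_pair E NE F NF p \<longleftrightarrow> dual_pair E NE F NF p \<and>
     continuous_map (prod_topology (norm_topology F NF) (norm_topology E NE)) euclideanreal
       (\<lambda>(g, f). p g f)"


section \<open>Vector-valued RKBSs, twin operators and adjoint pairs\<close>

definition vv_rkbs :: "('x \<Rightarrow> 'u::banach) set \<Rightarrow> (('x \<Rightarrow> 'u) \<Rightarrow> real) \<Rightarrow> bool" where
  "vv_rkbs B N \<longleftrightarrow> banach_on B N \<and> (\<forall>x. \<exists>C\<ge>0. \<forall>f\<in>B. norm (f x) \<le> C * N f)"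

text \<open>Throughout, \<open>'u\<close> stands for \<open>U\<close>, \<open>'v\<close> for \<open>U\<^sup>\<diamond>\<close>, and \<open>p\<close> for the pairing of \<open>(U, U\<^sup>\<diamond>)\<close>.\<close>

definition twin :: "('v::banach \<Rightarrow> 'u::banach \<Rightarrow> real) \<Rightarrow> ('v \<Rightarrow> 'u \<Rightarrow> real) set" where
  "twin p = {T. bounded_bilinear T \<and>
     (\<exists>TU TV. linear TU \<and> linear TV \<and> (\<forall>v u. p v (TU u) = T v u \<and> T v u = p (TV v) u))}"

text \<open>The operators \<open>T\<^sub>U\<close> and \<open>T\<^sub>U\<^sub>\<diamond>\<close> belonging to a twin operator \<open>T\<close>; they are unique because
  the pairing of a dual pair separates points.\<close>

definition twin_U :: "('v::banach \<Rightarrow> 'u::banach \<Rightarrow> real) \<Rightarrow> ('v \<Rightarrow> 'u \<Rightarrow> real) \<Rightarrow> 'u \<Rightarrow> 'u" where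
  "twin_U p T = (THE TU. linear TU \<and> (\<forall>v u. p v (TU u) = T v u))"

definition twin_Ud :: "('v::banach \<Rightarrow> 'u::banach \<Rightarrow> real) \<Rightarrow> ('v \<Rightarrow> 'u \<Rightarrow> real) \<Rightarrow> 'v \<Rightarrow> 'v" where
  "twin_Ud p T = (THE TV. linear TV \<and> (\<forall>v u. p (TV v) u = T v u))"

definition adjoint_pair :: "('v::banach \<Rightarrow> 'u::banach \<Rightarrow> real) \<Rightarrow>
    ('x \<Rightarrow> 'u) set \<Rightarrow> (('x \<Rightarrow> 'u) \<Rightarrow> real) \<Rightarrow>
    ('w \<Rightarrow> 'v) set \<Rightarrow> (('w \<Rightarrow> 'v) \<Rightarrow> real) \<Rightarrow>
    (('w \<Rightarrow> 'v) \<Rightarrow> ('x \<Rightarrow> 'u) \<Rightarrow> real) \<Rightarrow> ('x \<Rightarrow> 'w \<Rightarrow> 'v \<Rightarrow> 'u \<Rightarrow> real) \<Rightarrow> bool" where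
  "adjoint_pair p B NB Bd NBd pB K \<longleftrightarrow>
     dual_pair UNIV norm UNIV norm p \<and>
     vv_rkbs B NB \<and> vv_rkbs Bd NBd \<and>
     continuous_dual_pair B NB Bd NBd pB \<and>
     (\<forall>x w. K x w \<in> twin p) \<and>
     (\<forall>x v. (\<lambda>w. twin_Ud p (K x w) v) \<in> Bd \<and>
        (\<forall>f\<in>B. p v (f x) = pB (\<lambda>w. twin_Ud p (K x w) v) f)) \<and>
     (\<forall>w u. (\<lambda>x. twin_U p (K x w) u) \<in> B \<and>
        (\<forall>g\<in>Bd. p (g w) u = pB g (\<lambda>x. twin_U p (K x w) u)))"


section \<open>Vector measures and integration against them\<close>

text \<open>A vector measure is a set function of which only the values on Borel sets matter.
  That \<open>\<mu> {} = 0\<close> follows from additivity on the sequence of empty sets.\<close>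

definition vector_measure :: "('w::topological_space set \<Rightarrow> 'u::real_normed_vector) \<Rightarrow> bool" where
  "vector_measure \<mu> \<longleftrightarrow>
     (\<forall>A::nat \<Rightarrow> 'w set. range A \<subseteq> sets borel \<longrightarrow> disjoint_family A \<longrightarrow>
        (\<lambda>n. \<mu> (A n)) sums \<mu> (\<Union>n. A n))"

definition variation ::
    "('w::topological_space set \<Rightarrow> 'u::real_normed_vector) \<Rightarrow> 'w set \<Rightarrow> ennreal" where
  "variation \<mu> E =
     (SUP P\<in>{P. finite P \<and> P \<subseteq> sets borel \<and> disjoint P \<and> \<Union>P = E}. \<Sum>A\<in>P. ennreal (norm (\<mu> A)))"

definition regular_vmeas ::
    "('w::topological_space set \<Rightarrow> 'u::real_normed_vector) \<Rightarrow> bool" where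
  "regular_vmeas \<mu> \<longleftrightarrow>
     (\<forall>E\<in>sets borel. \<forall>e>0. \<exists>S G. compact S \<and> open G \<and> S \<subseteq> E \<and> E \<subseteq> G \<and>
        variation \<mu> (G - S) < ennreal e)"

definition vmeas :: "('w::topological_space set \<Rightarrow> 'u::banach) set" where
  "vmeas = {\<mu>. vector_measure \<mu> \<and> variation \<mu> UNIV < \<infinity> \<and> regular_vmeas \<mu>}"

text \<open>Integration of \<open>'a\<close>-valued functions against a \<open>'u\<close>-valued measure along a bilinear
  map \<open>b\<close>: for a simple function it is the finite sum of \<open>b v (\<mu> {s = v})\<close>, and uniform limits
  of simple functions are reached by continuity. With \<open>b\<close> the pairing \<open>p\<close> this is
  \<open>\<langle>\<mu>, g\<rangle>\<close>; with \<open>b\<close> scalar multiplication it is the integral of a scalar function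
  with respect to \<open>\<mu>\<close>.\<close>

definition simple_bint :: "('a \<Rightarrow> 'u \<Rightarrow> 'c) \<Rightarrow> ('w::topological_space set \<Rightarrow> 'u::banach) \<Rightarrow>
    ('w \<Rightarrow> 'a::banach) \<Rightarrow> 'c::banach" where
  "simple_bint b \<mu> s = (\<Sum>v\<in>range s. b v (\<mu> (s -` {v})))"

definition bint :: "('a \<Rightarrow> 'u \<Rightarrow> 'c) \<Rightarrow> ('w::topological_space set \<Rightarrow> 'u::banach) \<Rightarrow>
    ('w \<Rightarrow> 'a::banach) \<Rightarrow> 'c::banach" where
  "bint b \<mu> g = (THE I. \<exists>s. (\<forall>n::nat. simple_function borel (s n)) \<and>
     uniform_limit UNIV s g sequentially \<and> (\<lambda>n. simple_bint b \<mu> (s n)) \<longlonglongrightarrow> I)"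

definition C0 :: "('a::topological_space \<Rightarrow> real) set" where
  "C0 = {f. continuous_on UNIV f \<and> (\<forall>e>0. \<exists>S. compact S \<and> (\<forall>z. z \<notin> S \<longrightarrow> \<bar>f z\<bar> < e))}"


section \<open>The integral vv-RKBS pair\<close>

definition A_to_X :: "('x::topological_space \<times> 'w::topological_space \<Rightarrow> real) \<Rightarrow>
    ('w set \<Rightarrow> 'u::banach) \<Rightarrow> 'x \<Rightarrow> 'u" where
  "A_to_X \<phi> \<mu> = (\<lambda>x. bint scaleR \<mu> (\<lambda>w. \<phi> (x, w)))"

definition A_to_W :: "('x::topological_space \<times> 'w::topological_space \<Rightarrow> real) \<Rightarrow>
    ('x set \<Rightarrow> 'v::banach) \<Rightarrow> 'w \<Rightarrow> 'v" where
  "A_to_W \<phi> \<rho> = (\<lambda>w. bint scaleR \<rho> (\<lambda>x. \<phi> (x, w)))"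

definition int_B :: "('x::topological_space \<times> 'w::topological_space \<Rightarrow> real) \<Rightarrow>
    ('x \<Rightarrow> 'u::banach) set" where
  "int_B \<phi> = {A_to_X \<phi> \<mu> | \<mu>. \<mu> \<in> vmeas}"

definition int_norm :: "('x::topological_space \<times> 'w::topological_space \<Rightarrow> real) \<Rightarrow>
    ('x \<Rightarrow> 'u::banach) \<Rightarrow> real" where
  "int_norm \<phi> f = Inf {enn2real (variation \<mu> UNIV) | \<mu>. \<mu> \<in> vmeas \<and> f = A_to_X \<phi> \<mu>}"

definition int_Bd_pre :: "('x::topological_space \<times> 'w::topological_space \<Rightarrow> real) \<Rightarrow>
    ('w \<Rightarrow> 'v::banach) set" where
  "int_Bd_pre \<phi> = {A_to_W \<phi> \<rho> | \<rho>. \<rho> \<in> vmeas}"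

text \<open>The closure of \<^const>\<open>int_Bd_pre\<close> in the supremum norm.\<close>

definition int_Bd :: "('x::topological_space \<times> 'w::topological_space \<Rightarrow> real) \<Rightarrow>
    ('w \<Rightarrow> 'v::banach) set" where
  "int_Bd \<phi> = {g. \<exists>h. (\<forall>n::nat. h n \<in> int_Bd_pre \<phi>) \<and> uniform_limit UNIV h g sequentially}"

definition sup_norm :: "('w \<Rightarrow> 'v::real_normed_vector) \<Rightarrow> real" where
  "sup_norm g = (SUP w. norm (g w))"

text \<open>The common value of \<open>\<langle>\<mu>, g\<rangle>\<close> over all representing measures \<open>\<mu>\<close> of \<open>f\<close>.\<close>

definition int_pairing :: "('x::topological_space \<times> 'w::topological_space \<Rightarrow> real) \<Rightarrow>
    ('v::banach \<Rightarrow> 'u::banach \<Rightarrow> real) \<Rightarrow> ('w \<Rightarrow> 'v) \<Rightarrow> ('x \<Rightarrow> 'u) \<Rightarrow> real" where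
  "int_pairing \<phi> p g f = (THE r. \<forall>\<mu>\<in>vmeas. f = A_to_X \<phi> \<mu> \<longrightarrow> r = bint p \<mu> g)"

definition int_kernel :: "('x \<times> 'w \<Rightarrow> real) \<Rightarrow>
    ('v::banach \<Rightarrow> 'u::banach \<Rightarrow> real) \<Rightarrow> 'x \<Rightarrow> 'w \<Rightarrow> 'v \<Rightarrow> 'u \<Rightarrow> real" where
  "int_kernel \<phi> p x w v u = \<phi> (x, w) * p v u"

end

theory Submission
  imports Defs
begin

text \<open>The central point is that the pairing is well defined. A function in \<open>C\<^sub>0(X \<times> \<Omega>)\<close> is a uniform
  limit of functions \<open>a (c x) (d w)\<close> with \<open>c\<close> and \<open>d\<close> simple: off a compact set \<open>\<phi>\<close> is small, and
  the compact set is covered by finitely many open rectangles on which \<open>\<phi>\<close> oscillates little, so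
  \<open>c x\<close> and \<open>d w\<close> may record which sides of these rectangles contain \<open>x\<close> and \<open>w\<close>. For such
  functions, exchanging the order of integration is exchanging two finite sums; passing to the
  limit gives \<open>\<langle>\<mu>, A\<rho>\<rangle> = \<langle>\<rho>, A\<mu>\<rangle>\<close> without a product measure. Hence \<open>\<langle>\<mu>, g\<rangle>\<close> depends on \<open>\<mu>\<close> only
  through \<open>A\<mu>\<close> for \<open>g\<close> in the range of \<open>A\<close>, and then, by continuity, for \<open>g\<close> in its closure.

  Point masses turn this identity into the reproducing properties, which in turn give
  non-degeneracy. The space \<open>\<B>\<close> is complete because vector measures are complete in variation and
  \<open>\<B>\<close> carries the quotient norm: a rapidly Cauchy sequence in \<open>\<B>\<close> lifts to a Cauchy sequence of
  measures.\<close>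

section \<open>Vector measures\<close>

lemma vector_measure_empty:
  assumes "vector_measure \<mu>"
  shows "\<mu> {} = 0"
proof -
  have "(\<lambda>n::nat. \<mu> {}) sums \<mu> (\<Union>n::nat. {})"
    using assms unfolding vector_measure_def
    by (elim allE[where x = "\<lambda>_. {}"]) (auto simp: disjoint_family_on_def)
  then have "(\<lambda>n::nat. \<mu> {}) \<longlonglongrightarrow> 0"
    by (blast intro: summable_LIMSEQ_zero sums_summable)
  then show ?thesis
    by (simp add: LIMSEQ_const_iff)
qed

lemma vector_measure_lessThan:
  fixes A :: "nat \<Rightarrow> 'w::topological_space set"
  assumes "vector_measure \<mu>" "range A \<subseteq> sets borel" "disjoint_family A"
  shows "\<mu> (\<Union>i<n. A i) = (\<Sum>i<n. \<mu> (A i))"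
proof -
  \<comment> \<open>Padding with empty sets turns the finite union into a countable one; the added
    terms vanish because \<open>\<mu> {} = 0\<close>.\<close>
  define A' where "A' = (\<lambda>i. if i < n then A i else {})"
  have "range A' \<subseteq> sets borel" "disjoint_family A'"
    using assms(2,3) by (auto simp: A'_def disjoint_family_on_def)
  then have "(\<lambda>i. \<mu> (A' i)) sums \<mu> (\<Union>i. A' i)"
    using assms(1) by (simp add: vector_measure_def)
  moreover have "(\<Union>i. A' i) = (\<Union>i<n. A i)"
    by (auto simp: A'_def split: if_splits)
  moreover have "(\<lambda>i. \<mu> (A' i)) sums (\<Sum>i<n. \<mu> (A' i))"
    by (rule sums_finite) (auto simp: A'_def vector_measure_empty[OF assms(1)])
  ultimately show ?thesis
    by (simp add: A'_def sums_unique2)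
qed

lemma vector_measure_Un:
  assumes "vector_measure \<mu>" "A \<in> sets borel" "B \<in> sets borel" "A \<inter> B = {}"
  shows "\<mu> (A \<union> B) = \<mu> A + \<mu> B"
proof -
  have "range (binaryset A B) \<subseteq> sets borel" "disjoint_family (binaryset A B)"
    using assms by (auto simp: range_binaryset_eq disjoint_family_on_def binaryset_def)
  from vector_measure_lessThan[OF assms(1) this, of 2] show ?thesis
    by (simp add: binaryset_def lessThan_Suc numeral_2_eq_2 Un_commute add.commute)
qed

lemma vector_measure_UN:
  assumes "vector_measure \<mu>" "finite I" "\<And>i. i \<in> I \<Longrightarrow> A i \<in> sets borel" "disjoint_family_on A I"
  shows "\<mu> (\<Union>i\<in>I. A i) = (\<Sum>i\<in>I. \<mu> (A i))"
  using assms(2-)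
proof (induction I)
  case empty
  then show ?case by (simp add: vector_measure_empty[OF assms(1)])
next
  case (insert i I)
  have "\<mu> (A i \<union> (\<Union>i\<in>I. A i)) = \<mu> (A i) + \<mu> (\<Union>i\<in>I. A i)"
    using insert.hyps insert.prems
    by (intro vector_measure_Un[OF assms(1)]) (auto simp: disjoint_family_on_def)
  then show ?case
    using insert by (auto simp: disjoint_family_on_def)
qed

section \<open>Variation of a vector measure\<close>

text \<open>The supremum in \<open>variation\<close> runs over exact partitions of \<open>E\<close>.
  A disjoint family that only lies inside \<open>E\<close> is completed to a partition by its
  remainder, which can only enlarge the sum.\<close>

lemma variation_upper:
  assumes "finite P" "P \<subseteq> sets borel" "disjoint P" "\<Union>P \<subseteq> E" "E \<in> sets borel"
  shows "(\<Sum>A\<in>P. ennreal (norm (\<mu> A))) \<le> variation \<mu> E"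
proof -
  let ?Q = "insert (E - \<Union>P) P"
  have "\<Union>P \<in> sets borel"
    using assms by (intro sets.finite_Union) auto
  then have "E - \<Union>P \<in> sets borel"
    using assms(5) by blast
  moreover have "disjoint ?Q"
    using assms(3) by (auto simp: disjoint_def)
  ultimately have "(\<Sum>A\<in>?Q. ennreal (norm (\<mu> A))) \<le> variation \<mu> E"
    unfolding variation_def using assms by (intro SUP_upper) auto
  moreover have "(\<Sum>A\<in>P. ennreal (norm (\<mu> A))) \<le> (\<Sum>A\<in>?Q. ennreal (norm (\<mu> A)))"
    using assms(1) by (intro sum_mono2) auto
  ultimately show ?thesis by order
qed

lemma variation_least:
  assumes "\<And>P. finite P \<Longrightarrow> P \<subseteq> sets borel \<Longrightarrow> disjoint P \<Longrightarrow> \<Union>P = E \<Longrightarrow>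
    (\<Sum>A\<in>P. ennreal (norm (\<mu> A))) \<le> c"
  shows "variation \<mu> E \<le> c"
  unfolding variation_def using assms by (intro SUP_least) auto

lemma variation_mono:
  assumes "E \<subseteq> F" "F \<in> sets borel"
  shows "variation \<mu> E \<le> variation \<mu> F"
  by (rule variation_least, rule variation_upper) (use assms in auto)

lemma variation_add_le: "variation (\<mu> + \<nu>) E \<le> variation \<mu> E + variation \<nu> E"
proof (rule variation_least)
  fix P assume P: "finite P" "P \<subseteq> sets borel" "disjoint P" "\<Union>P = E"
  \<comment> \<open>Having a finite Borel partition makes \<open>E\<close> itself Borel; for any
    other \<open>E\<close> the supremum is over the empty set.\<close>
  then have "E \<in> sets borel"
    using sets.finite_Union by blast
  have "(\<Sum>A\<in>P. ennreal (norm ((\<mu> + \<nu>) A))) \<le> (\<Sum>A\<in>P. ennreal (norm (\<mu> A)) + ennreal (norm (\<nu> A)))"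
    by (intro sum_mono) (simp flip: ennreal_plus add: norm_triangle_ineq)
  also have "\<dots> \<le> variation \<mu> E + variation \<nu> E"
    unfolding sum.distrib using P \<open>E \<in> sets borel\<close> by (intro add_mono variation_upper) auto
  finally show "(\<Sum>A\<in>P. ennreal (norm ((\<mu> + \<nu>) A))) \<le> variation \<mu> E + variation \<nu> E" .
qed

lemma variation_scaleR_le: "variation (c *\<^sub>R \<mu>) E \<le> ennreal \<bar>c\<bar> * variation \<mu> E"
proof (rule variation_least)
  fix P assume P: "finite P" "P \<subseteq> sets borel" "disjoint P" "\<Union>P = E"
  then have "E \<in> sets borel"
    using sets.finite_Union by blast
  have "(\<Sum>A\<in>P. ennreal (norm ((c *\<^sub>R \<mu>) A))) = ennreal \<bar>c\<bar> * (\<Sum>A\<in>P. ennreal (norm (\<mu> A)))"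
    by (simp add: sum_distrib_left ennreal_mult del: sum_ennreal)
  also have "\<dots> \<le> ennreal \<bar>c\<bar> * variation \<mu> E"
    using P \<open>E \<in> sets borel\<close> by (intro mult_left_mono variation_upper) auto
  finally show "(\<Sum>A\<in>P. ennreal (norm ((c *\<^sub>R \<mu>) A))) \<le> ennreal \<bar>c\<bar> * variation \<mu> E" .
qed

lemma variation_zero [simp]: "variation 0 E = 0"
proof -
  have "variation 0 E \<le> 0"
    by (rule variation_least) simp
  then show ?thesis by simp
qed

lemma vmeas_regular:
  assumes "\<mu> \<in> vmeas" "E \<in> sets borel" "0 < e"
  obtains S G where "compact S" "open G" "S \<subseteq> E" "E \<subseteq> G" "variation \<mu> (G - S) < ennreal e"
proof -
  have "regular_vmeas \<mu>"
    using assms(1) by (simp add: vmeas_def)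
  then have "\<exists>S G. compact S \<and> open G \<and> S \<subseteq> E \<and> E \<subseteq> G \<and> variation \<mu> (G - S) < ennreal e"
    unfolding regular_vmeas_def using assms(2,3) by simp
  then show thesis
    using that by blast
qed

section \<open>Linear structure of the space of regular measures\<close>

lemma vmeas_zero: "0 \<in> vmeas"
proof -
  have "vector_measure 0"
    by (simp add: vector_measure_def)
  moreover have "regular_vmeas 0"
    unfolding regular_vmeas_def by (intro ballI allI impI exI[of _ "{}"] exI[of _ UNIV]) simp
  ultimately show ?thesis
    by (simp add: vmeas_def)
qed

lemma vmeas_add:
  fixes \<mu> \<nu> :: "'w::t2_space set \<Rightarrow> 'u::banach"
  assumes "\<mu> \<in> vmeas" "\<nu> \<in> vmeas"
  shows "\<mu> + \<nu> \<in> vmeas"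
proof -
  have "vector_measure (\<mu> + \<nu>)"
    using assms by (auto simp: vmeas_def vector_measure_def intro!: sums_add)
  moreover have "variation (\<mu> + \<nu>) UNIV < \<infinity>"
    using assms order.strict_trans1[OF variation_add_le[of \<mu> \<nu> UNIV]] by (simp add: vmeas_def)
  moreover have "regular_vmeas (\<mu> + \<nu>)"
    unfolding regular_vmeas_def
  proof (intro ballI allI impI)
    fix E :: "'w set" and e :: real
    assume E: "E \<in> sets borel" and "0 < e"
    then have "0 < e / 2" by simp
    obtain S G where
      SG: "compact S" "open G" "S \<subseteq> E" "E \<subseteq> G" "variation \<mu> (G - S) < ennreal (e / 2)"
      by (rule vmeas_regular[OF assms(1) E \<open>0 < e / 2\<close>])
    obtain S' G' where
      SG': "compact S'" "open G'" "S' \<subseteq> E" "E \<subseteq> G'" "variation \<nu> (G' - S') < ennreal (e / 2)"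
      by (rule vmeas_regular[OF assms(2) E \<open>0 < e / 2\<close>])
    \<comment> \<open>\<open>S \<union> S'\<close> is compact and \<open>G \<inter> G'\<close> is
      open, and their difference lies in both \<open>G - S\<close> and \<open>G' - S'\<close>. In a
      Hausdorff space compact sets are closed, so these differences are Borel and monotonicity of
      the variation applies.\<close>
    let ?D = "G \<inter> G' - (S \<union> S')"
    have "variation \<mu> ?D \<le> variation \<mu> (G - S)" "variation \<nu> ?D \<le> variation \<nu> (G' - S')"
      using SG SG' by (auto intro!: variation_mono sets.Diff simp: compact_imp_closed)
    then have "variation (\<mu> + \<nu>) ?D \<le> variation \<mu> (G - S) + variation \<nu> (G' - S')"
      using variation_add_le[of \<mu> \<nu> ?D] by (meson add_mono order_trans)
    also have "\<dots> < ennreal e"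
      using add_mono_ennreal[OF SG(5) SG'(5)] by simp
    finally show "\<exists>S G. compact S \<and> open G \<and> S \<subseteq> E \<and> E \<subseteq> G \<and> variation (\<mu> + \<nu>) (G - S) < ennreal e"
      using SG SG' by (intro exI[of _ "S \<union> S'"] exI[of _ "G \<inter> G'"]) auto
  qed
  ultimately show ?thesis
    by (simp add: vmeas_def)
qed

lemma vmeas_scaleR:
  fixes \<mu> :: "'w::topological_space set \<Rightarrow> 'u::banach"
  assumes "\<mu> \<in> vmeas"
  shows "c *\<^sub>R \<mu> \<in> vmeas"
proof -
  have "vector_measure (c *\<^sub>R \<mu>)"
    using assms by (auto simp: vmeas_def vector_measure_def intro!: sums_scaleR_right)
  moreover have "variation (c *\<^sub>R \<mu>) UNIV < \<infinity>"
    using assms order.strict_trans1[OF variation_scaleR_le[of c \<mu> UNIV]]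
    by (simp add: vmeas_def ennreal_mult_less_top)
  moreover have "regular_vmeas (c *\<^sub>R \<mu>)"
    unfolding regular_vmeas_def
  proof (intro ballI allI impI)
    fix E :: "'w set" and e :: real
    assume E: "E \<in> sets borel" and "0 < e"
    \<comment> \<open>Dividing by \<open>\<bar>c\<bar> + 1\<close> covers \<open>c = 0\<close> and
      leaves room for a strict inequality after multiplication by
      \<open>\<bar>c\<bar>\<close>.\<close>
    then have "0 < e / (\<bar>c\<bar> + 1)" by simp
    obtain S G where
      SG: "compact S" "open G" "S \<subseteq> E" "E \<subseteq> G" "variation \<mu> (G - S) < ennreal (e / (\<bar>c\<bar> + 1))"
      by (rule vmeas_regular[OF assms E \<open>0 < e / (\<bar>c\<bar> + 1)\<close>])
    have "variation (c *\<^sub>R \<mu>) (G - S) \<le> ennreal \<bar>c\<bar> * ennreal (e / (\<bar>c\<bar> + 1))"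
      by (rule order.trans[OF variation_scaleR_le]) (rule mult_left_mono[OF less_imp_le[OF SG(5)]], simp)
    also have "\<dots> = ennreal (\<bar>c\<bar> * (e / (\<bar>c\<bar> + 1)))"
      using \<open>0 < e\<close> by (intro ennreal_mult[symmetric]) auto
    also have "\<dots> < ennreal e"
    proof (rule ennreal_lessI)
      show "\<bar>c\<bar> * (e / (\<bar>c\<bar> + 1)) < e"
        using \<open>0 < e\<close> mult_strict_right_mono[of "\<bar>c\<bar>" "\<bar>c\<bar> + 1" e] by (simp add: pos_divide_less_eq mult.commute)
    qed (fact \<open>0 < e\<close>)
    finally show "\<exists>S G. compact S \<and> open G \<and> S \<subseteq> E \<and> E \<subseteq> G \<and> variation (c *\<^sub>R \<mu>) (G - S) < ennreal e"
      using SG by blast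
  qed
  ultimately show ?thesis
    by (simp add: vmeas_def)
qed

lemma subspace_vmeas: "subspace (vmeas :: ('w::t2_space set \<Rightarrow> 'u::banach) set)"
  by (intro subspaceI vmeas_zero vmeas_add vmeas_scaleR)

section \<open>Total variation as a real number, and completeness\<close>

text \<open>On \<open>vmeas\<close> the variation is finite and nothing is lost by
  \<open>enn2real\<close>. As values off the Borel sets are ignored, this is a seminorm on
  \<open>vmeas\<close> rather than a norm.\<close>

definition tvar :: "('w::topological_space set \<Rightarrow> 'u::real_normed_vector) \<Rightarrow> real" where
  "tvar \<mu> = enn2real (variation \<mu> UNIV)"

lemma tvar_nonneg [simp]: "0 \<le> tvar \<mu>"
  by (simp add: tvar_def)

lemma ennreal_tvar: "\<mu> \<in> vmeas \<Longrightarrow> ennreal (tvar \<mu>) = variation \<mu> UNIV"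
  by (simp add: tvar_def vmeas_def)

lemma tvar_le:
  assumes "variation \<mu> UNIV \<le> ennreal c" "0 \<le> c"
  shows "tvar \<mu> \<le> c"
  unfolding tvar_def using assms by (intro enn2real_leI)

lemma tvar_add_le:
  assumes "\<mu> \<in> vmeas" "\<nu> \<in> vmeas"
  shows "tvar (\<mu> + \<nu>) \<le> tvar \<mu> + tvar \<nu>"
  using variation_add_le[of \<mu> \<nu> UNIV] assms by (intro tvar_le) (auto simp: ennreal_tvar)

lemma tvar_scaleR_le:
  assumes "\<mu> \<in> vmeas"
  shows "tvar (c *\<^sub>R \<mu>) \<le> \<bar>c\<bar> * tvar \<mu>"
  using variation_scaleR_le[of c \<mu> UNIV] assms
  by (intro tvar_le) (auto simp: ennreal_mult ennreal_tvar)

lemma sum_norm_le_tvar: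
  assumes "\<mu> \<in> vmeas" "finite P" "P \<subseteq> sets borel" "disjoint P"
  shows "(\<Sum>A\<in>P. norm (\<mu> A)) \<le> tvar \<mu>"
proof -
  have "ennreal (\<Sum>A\<in>P. norm (\<mu> A)) \<le> ennreal (tvar \<mu>)"
    using variation_upper[OF assms(2-4), of UNIV \<mu>] assms(1) by (simp add: ennreal_tvar)
  then show ?thesis by simp
qed

lemma norm_le_tvar:
  assumes "\<mu> \<in> vmeas" "E \<in> sets borel"
  shows "norm (\<mu> E) \<le> tvar \<mu>"
  using sum_norm_le_tvar[OF assms(1), of "{E}"] assms(2) by simp

text \<open>Countable additivity says that the values on the partial unions converge to the value on
  the whole union. Uniformity over all Borel sets permits exchanging this limit with the one in
  \<open>n\<close>; finite additivity passes to the limit pointwise.\<close>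

lemma vector_measure_uniform_limit:
  assumes T: "\<And>n. vector_measure (T n)" and lim: "uniform_limit (sets borel) T \<mu> sequentially"
  shows "vector_measure \<mu>"
  unfolding vector_measure_def
proof (intro allI impI)
  fix A :: "nat \<Rightarrow> 'a set"
  assume A: "range A \<subseteq> sets borel" "disjoint_family A"
  have UA: "(\<Union>i<m. A i) \<in> sets borel" "(\<Union>i. A i) \<in> sets borel" for m
    using A(1) by auto
  have lim': "(\<lambda>n. T n E) \<longlonglongrightarrow> \<mu> E" if "E \<in> sets borel" for E
    using lim that by (rule tendsto_uniform_limitI)
  have "(\<lambda>m. \<mu> (\<Union>i<m. A i)) \<longlonglongrightarrow> \<mu> (\<Union>i. A i)"
  proof (rule swap_uniform_limit'[OF _ lim'[OF UA(2)]])
    show "uniform_limit UNIV (\<lambda>n m. T n (\<Union>i<m. A i)) (\<lambda>m. \<mu> (\<Union>i<m. A i)) sequentially"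
      using lim UA(1) unfolding uniform_limit_iff by (fast elim: eventually_mono)
    show "\<forall>\<^sub>F n in sequentially. (\<lambda>m. T n (\<Union>i<m. A i)) \<longlonglongrightarrow> T n (\<Union>i. A i)"
      using T A by (simp add: vector_measure_lessThan[OF T A]) (simp add: vector_measure_def sums_def)
  qed auto
  moreover have "\<mu> (\<Union>i<m. A i) = (\<Sum>i<m. \<mu> (A i))" for m
  proof (rule LIMSEQ_unique)
    show "(\<lambda>n. T n (\<Union>i<m. A i)) \<longlonglongrightarrow> \<mu> (\<Union>i<m. A i)"
      by (rule lim'[OF UA(1)])
    show "(\<lambda>n. T n (\<Union>i<m. A i)) \<longlonglongrightarrow> (\<Sum>i<m. \<mu> (A i))"
      unfolding vector_measure_lessThan[OF T A] using A(1) by (intro tendsto_sum lim') auto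
  qed
  ultimately show "(\<lambda>n. \<mu> (A n)) sums \<mu> (\<Union>n. A n)"
    by (simp add: sums_def)
qed

text \<open>Since \<open>norm (\<nu> E) \<le> tvar \<nu>\<close>, a sequence that is Cauchy in
  variation is uniformly Cauchy on the Borel sets. Its uniform limit is the required
  measure.\<close>

lemma vmeas_complete:
  fixes T :: "nat \<Rightarrow> 'w::t2_space set \<Rightarrow> 'u::banach"
  assumes T: "\<And>n. T n \<in> vmeas"
    and Cauchy: "\<And>e. 0 < e \<Longrightarrow> \<exists>N. \<forall>m\<ge>N. \<forall>n\<ge>N. tvar (T m - T n) \<le> e"
  obtains \<mu> where "\<mu> \<in> vmeas" "(\<lambda>n. tvar (T n - \<mu>)) \<longlonglongrightarrow> 0"
proof -
  note diff = subspace_diff[OF subspace_vmeas]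
  have "uniformly_Cauchy_on (sets borel) T"
    unfolding uniformly_Cauchy_on_def
  proof (intro allI impI)
    fix e :: real assume "0 < e"
    then obtain N where N: "\<And>m n. m \<ge> N \<Longrightarrow> n \<ge> N \<Longrightarrow> tvar (T m - T n) \<le> e / 2"
      using Cauchy[of "e / 2"] by auto
    have "dist (T m E) (T n E) < e" if "E \<in> sets borel" "m \<ge> N" "n \<ge> N" for E m n
    proof -
      have "dist (T m E) (T n E) = norm ((T m - T n) E)"
        by (simp add: dist_norm)
      also have "\<dots> \<le> e / 2"
        using norm_le_tvar[OF diff[OF T T] that(1)] N[OF that(2,3)] by (rule order.trans)
      finally show ?thesis using \<open>0 < e\<close> by simp
    qed
    then show "\<exists>M. \<forall>E\<in>sets borel. \<forall>m\<ge>M. \<forall>n\<ge>M. dist (T m E) (T n E) < e"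
      by blast
  qed
  then have "uniformly_convergent_on (sets borel) T"
    by (rule Cauchy_uniformly_convergent)
  then obtain \<mu> where lim: "uniform_limit (sets borel) T \<mu> sequentially"
    unfolding uniformly_convergent_on_def by blast
  have lim': "(\<lambda>n. T n E) \<longlonglongrightarrow> \<mu> E" if "E \<in> sets borel" for E
    using lim that by (rule tendsto_uniform_limitI)
  have "vector_measure \<mu>"
    by (rule vector_measure_uniform_limit[OF _ lim]) (use T in \<open>simp add: vmeas_def\<close>)
  \<comment> \<open>Lower semicontinuity of the variation: for one partition and one
    \<open>n\<close>, the finite sum for \<open>T n - T m\<close> stays below \<open>e\<close> as
    \<open>m\<close> tends to infinity; only then is the supremum over partitions taken.\<close>
  have close: "\<exists>N. \<forall>n\<ge>N. variation (T n - \<mu>) UNIV \<le> ennreal e" if "0 < e" for e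
  proof -
    obtain N where N: "\<And>m n. m \<ge> N \<Longrightarrow> n \<ge> N \<Longrightarrow> tvar (T m - T n) \<le> e"
      using Cauchy[OF \<open>0 < e\<close>] by auto
    have "variation (T n - \<mu>) UNIV \<le> ennreal e" if "n \<ge> N" for n
    proof (rule variation_least)
      fix P :: "'w set set"
      assume P: "finite P" "P \<subseteq> sets borel" "disjoint P" "\<Union>P = UNIV"
      have "(\<lambda>m. \<Sum>A\<in>P. norm (T n A - T m A)) \<longlonglongrightarrow> (\<Sum>A\<in>P. norm (T n A - \<mu> A))"
        using P by (intro tendsto_sum tendsto_norm tendsto_diff tendsto_const lim') auto
      moreover have "(\<Sum>A\<in>P. norm (T n A - T m A)) \<le> e" if "m \<ge> N" for m
        using sum_norm_le_tvar[OF diff[OF T T], OF P(1-3), of n m] N[OF \<open>n \<ge> N\<close> that] by simp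
      ultimately have "(\<Sum>A\<in>P. norm (T n A - \<mu> A)) \<le> e"
        by (blast intro: LIMSEQ_le_const2)
      then show "(\<Sum>A\<in>P. ennreal (norm ((T n - \<mu>) A))) \<le> ennreal e"
        by (simp add: ennreal_leI)
    qed
    then show ?thesis by blast
  qed
  \<comment> \<open>Writes \<open>\<mu>\<close> as \<open>T n - (T n - \<mu>)\<close>. The error
    term does not depend on \<open>E\<close>, so finiteness and regularity are both inherited from a
    single \<open>T n\<close>.\<close>
  have variation_le: "variation \<mu> E \<le> variation (T n) E + variation (T n - \<mu>) UNIV"
    if "E \<in> sets borel" for E n
  proof -
    have "variation \<mu> E = variation (T n + (-1) *\<^sub>R (T n - \<mu>)) E"
      by (simp add: algebra_simps)
    also have "\<dots> \<le> variation (T n) E + variation ((-1) *\<^sub>R (T n - \<mu>)) E"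
      by (rule variation_add_le)
    also have "variation ((-1) *\<^sub>R (T n - \<mu>)) E \<le> variation (T n - \<mu>) E"
      using variation_scaleR_le[of "-1" "T n - \<mu>" E] by simp
    also have "variation (T n - \<mu>) E \<le> variation (T n - \<mu>) UNIV"
      by (rule variation_mono) auto
    finally show ?thesis by (simp add: add_left_mono)
  qed
  have "variation \<mu> UNIV < \<infinity>"
  proof -
    obtain N where "variation (T N - \<mu>) UNIV \<le> ennreal 1"
      using close[of 1] by auto
    moreover have "variation (T N) UNIV < \<infinity>"
      using T by (simp add: vmeas_def)
    ultimately show ?thesis
      using variation_le[of UNIV N] by (auto simp: less_top[symmetric] top_unique)
  qed
  moreover have "regular_vmeas \<mu>"
    unfolding regular_vmeas_def
  proof (intro ballI allI impI)
    fix E :: "'w set" and e :: real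
    assume E: "E \<in> sets borel" and "0 < e"
    \<comment> \<open>\<open>close\<close> yields a weak inequality; asking for \<open>e / 4\<close>
      gives a value strictly below \<open>e / 2\<close>.\<close>
    obtain n where "variation (T n - \<mu>) UNIV \<le> ennreal (e / 4)"
      using close[of "e / 4"] \<open>0 < e\<close> by auto
    also have "\<dots> < ennreal (e / 2)"
      using \<open>0 < e\<close> by (intro ennreal_lessI) auto
    finally have n: "variation (T n - \<mu>) UNIV < ennreal (e / 2)" .
    obtain S G where SG: "compact S" "open G" "S \<subseteq> E" "E \<subseteq> G" "variation (T n) (G - S) < ennreal (e / 2)"
      by (rule vmeas_regular[OF T E half_gt_zero[OF \<open>0 < e\<close>]])
    have "variation \<mu> (G - S) \<le> variation (T n) (G - S) + variation (T n - \<mu>) UNIV"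
      using SG by (intro variation_le) (simp add: compact_imp_closed sets.Diff)
    also have "\<dots> < ennreal e"
      using add_mono_ennreal[OF SG(5) n] by simp
    finally show "\<exists>S G. compact S \<and> open G \<and> S \<subseteq> E \<and> E \<subseteq> G \<and> variation \<mu> (G - S) < ennreal e"
      using SG by blast
  qed
  ultimately have \<mu>: "\<mu> \<in> vmeas"
    using \<open>vector_measure \<mu>\<close> by (simp add: vmeas_def)
  moreover have "(\<lambda>n. tvar (T n - \<mu>)) \<longlonglongrightarrow> 0"
  proof (rule LIMSEQ_I)
    fix e :: real assume "0 < e"
    then obtain N where "\<And>n. n \<ge> N \<Longrightarrow> variation (T n - \<mu>) UNIV \<le> ennreal (e / 2)"
      using close[of "e / 2"] by auto
    then have "tvar (T n - \<mu>) \<le> e / 2" if "n \<ge> N" for n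
      using that \<open>0 < e\<close> by (intro tvar_le) auto
    moreover have "e / 2 < e"
      using \<open>0 < e\<close> by simp
    ultimately have "norm (tvar (T n - \<mu>) - 0) < e" if "n \<ge> N" for n
      using order.strict_trans1 that by fastforce
    then show "\<exists>N. \<forall>n\<ge>N. norm (tvar (T n - \<mu>) - 0) < e"
      by blast
  qed
  ultimately show thesis by (rule that)
qed

section \<open>Integration of uniform limits of simple functions\<close>

text \<open>The domain of \<open>bint\<close>: for any other integrand no approximating sequence
  exists, and its definite description determines no value.\<close>

definition uniformly_simple :: "('w::topological_space \<Rightarrow> 'a::real_normed_vector) \<Rightarrow> bool" where
  "uniformly_simple g \<longleftrightarrow>
     (\<exists>s. (\<forall>n::nat. simple_function borel (s n)) \<and> uniform_limit UNIV s g sequentially)"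

lemma uniform_limit_inverse_Suc:
  assumes "\<And>n w. dist (s n w) (g w) < inverse (real (Suc n))"
  shows "uniform_limit UNIV s g sequentially"
  unfolding uniform_limit_sequentially_iff
proof (intro allI impI)
  fix e :: real assume "0 < e"
  then obtain N where N: "inverse (real (Suc N)) < e"
    using reals_Archimedean by blast
  have "dist (s n w) (g w) < e" if "N \<le> n" for n w
  proof -
    have "dist (s n w) (g w) < inverse (real (Suc n))" by (rule assms)
    also have "\<dots> \<le> inverse (real (Suc N))" using that by (intro le_imp_inverse_le) auto
    also note N
    finally show ?thesis .
  qed
  then show "\<exists>N. \<forall>n\<ge>N. \<forall>w\<in>UNIV. dist (s n w) (g w) < e" by blast
qed

lemma uniformly_simpleI:
  assumes "\<And>e. 0 < e \<Longrightarrow> \<exists>s. simple_function borel s \<and> (\<forall>w. dist (s w) (g w) < e)"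
  shows "uniformly_simple g"
proof -
  have "\<forall>n. \<exists>s. simple_function borel s \<and> (\<forall>w. dist (s w) (g w) < inverse (real (Suc n)))"
    using assms by simp
  then obtain s where "\<And>n. simple_function borel (s n)"
    "\<And>n w. dist (s n w) (g w) < inverse (real (Suc n))"
    by metis
  then show ?thesis
    unfolding uniformly_simple_def using uniform_limit_inverse_Suc by blast
qed

lemma uniformly_simpleD:
  assumes "uniformly_simple g" "0 < e"
  obtains s where "simple_function borel s" "\<And>w. dist (s w) (g w) < e"
proof -
  obtain s where s: "\<And>n. simple_function borel (s n)" and "uniform_limit UNIV s g sequentially"
    using assms(1) by (auto simp: uniformly_simple_def)
  then obtain n where "\<forall>w. dist (s n w) (g w) < e"
    using assms(2) unfolding uniform_limit_sequentially_iff by blast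
  with s show thesis by (blast intro: that)
qed

lemma uniformly_simple_limit:
  assumes "\<And>n. uniformly_simple (g n)" "uniform_limit UNIV g h sequentially"
  shows "uniformly_simple h"
proof (rule uniformly_simpleI)
  fix e :: real assume "0 < e"
  then obtain n where n: "\<And>w. dist (g n w) (h w) < e / 2"
    using assms(2) unfolding uniform_limit_sequentially_iff by (metis UNIV_I half_gt_zero order_refl)
  obtain s where s: "simple_function borel s" "\<And>w. dist (s w) (g n w) < e / 2"
    by (rule uniformly_simpleD[OF assms(1)[of n] half_gt_zero[OF \<open>0 < e\<close>]]) blast
  have "dist (s w) (h w) < e" for w
    by (rule dist_triangle_half_r[of "g n w"]) (use s n in \<open>simp_all add: dist_commute\<close>)
  with s show "\<exists>s. simple_function borel s \<and> (\<forall>w. dist (s w) (h w) < e)" by blast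
qed

lemma simple_imp_uniformly_simple: "simple_function borel s \<Longrightarrow> uniformly_simple s"
  by (rule uniformly_simpleI) auto

lemma uniformly_simple_add:
  assumes "uniformly_simple g" "uniformly_simple h"
  shows "uniformly_simple (\<lambda>w. g w + h w)"
proof -
  obtain s t where "\<And>n. simple_function borel (s n)" "uniform_limit UNIV s g sequentially"
    "\<And>n. simple_function borel (t n)" "uniform_limit UNIV t h sequentially"
    using assms by (auto simp: uniformly_simple_def)
  then show ?thesis
    unfolding uniformly_simple_def
    by (intro exI[of _ "\<lambda>n w. s n w + t n w"] conjI allI uniform_limit_add simple_function_add)
qed

lemma uniform_limit_scaleR_const:
  fixes g :: "'w \<Rightarrow> 'a::real_normed_vector"
  assumes "uniform_limit UNIV s g F"
  shows "uniform_limit UNIV (\<lambda>n w. c *\<^sub>R s n w) (\<lambda>w. c *\<^sub>R g w) F"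
  using bounded_linear.uniform_limit[OF bounded_linear_scaleR_right assms] .

lemma uniformly_simple_scaleR:
  assumes "uniformly_simple g"
  shows "uniformly_simple (\<lambda>w. c *\<^sub>R g w)"
proof -
  obtain s where "\<And>n. simple_function borel (s n)" "uniform_limit UNIV s g sequentially"
    using assms by (auto simp: uniformly_simple_def)
  then show ?thesis
    unfolding uniformly_simple_def
    by (intro exI[of _ "\<lambda>n w. c *\<^sub>R s n w"] conjI allI uniform_limit_scaleR_const)
      (rule simple_function_compose1)
qed

section \<open>The integral along a bounded bilinear map\<close>

text \<open>Integration is developed once for a bounded bilinear \<open>b\<close> and used three
  times: for \<open>scaleR\<close>, for the pairing \<open>p\<close>, and for \<open>p\<close> with
  its arguments exchanged.\<close>

locale banach_bilinear = bounded_bilinear b for b :: "'a::banach \<Rightarrow> 'u::banach \<Rightarrow> 'c::banach"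
begin

text \<open>\<open>simple_bint\<close> sums over the values of the integrand, so two integrands are
  summed over unrelated sets. If both factor through one simple \<open>c\<close>, both sums can be
  taken over the level sets of \<open>c\<close>, by grouping these according to the value of
  \<open>h\<close>.\<close>

lemma simple_bint_compose:
  assumes \<mu>: "vector_measure \<mu>" and c: "simple_function borel c"
  shows "simple_bint b \<mu> (\<lambda>w. h (c w)) = (\<Sum>t\<in>range c. b (h t) (\<mu> (c -` {t})))"
proof -
  have fin: "finite (range c)" and meas: "c -` {t} \<in> sets borel" for t
    using simple_functionD(1)[OF c] simple_functionD(2)[OF c, of "{t}"] by simp_all
  have level: "\<mu> ((\<lambda>w. h (c w)) -` {v}) = (\<Sum>t\<in>{t\<in>range c. h t = v}. \<mu> (c -` {t}))" for v
  proof -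
    have "(\<lambda>w. h (c w)) -` {v} = (\<Union>t\<in>{t\<in>range c. h t = v}. c -` {t})" by auto
    also have "\<mu> \<dots> = (\<Sum>t\<in>{t\<in>range c. h t = v}. \<mu> (c -` {t}))"
      using fin meas by (intro vector_measure_UN[OF \<mu>]) (auto simp: disjoint_family_on_def)
    finally show ?thesis .
  qed
  have "simple_bint b \<mu> (\<lambda>w. h (c w)) =
      (\<Sum>v\<in>h ` range c. \<Sum>t\<in>{t\<in>range c. h t = v}. b (h t) (\<mu> (c -` {t})))"
    unfolding simple_bint_def level sum_right by (simp add: image_image)
  also have "\<dots> = (\<Sum>t\<in>range c. b (h t) (\<mu> (c -` {t})))"
    by (rule sum.image_gen[OF fin, symmetric])
  finally show ?thesis .
qed

lemma simple_bint_add: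
  assumes "vector_measure \<mu>" "simple_function borel s" "simple_function borel s'"
  shows "simple_bint b \<mu> (\<lambda>w. s w + s' w) = simple_bint b \<mu> s + simple_bint b \<mu> s'"
proof -
  \<comment> \<open>The common refinement: \<open>s\<close>, \<open>s'\<close> and their sum are all
    functions of this pair.\<close>
  have c: "simple_function borel (\<lambda>w. (s w, s' w))"
    using assms by (intro simple_function_Pair)
  show ?thesis
    using simple_bint_compose[OF assms(1) c, of "\<lambda>t. fst t + snd t"]
      simple_bint_compose[OF assms(1) c, of fst] simple_bint_compose[OF assms(1) c, of snd]
    by (simp add: add_left sum.distrib)
qed

lemma simple_bint_scaleR:
  assumes "vector_measure \<mu>" "simple_function borel s"
  shows "simple_bint b \<mu> (\<lambda>w. r *\<^sub>R s w) = r *\<^sub>R simple_bint b \<mu> s"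
  using simple_bint_compose[OF assms, of "\<lambda>t. r *\<^sub>R t"]
  by (simp add: simple_bint_def scaleR_left scaleR_sum_right)

lemma simple_bint_norm_le:
  assumes \<mu>: "\<mu> \<in> vmeas" and s: "simple_function borel s" and M: "\<And>w. norm (s w) \<le> M"
    and C: "0 \<le> C" "\<And>v u. norm (b v u) \<le> C * norm v * norm u"
  shows "norm (simple_bint b \<mu> s) \<le> C * M * tvar \<mu>"
proof -
  have fin: "finite (range s)" and meas: "s -` {v} \<in> sets borel" for v
    using simple_functionD(1)[OF s] simple_functionD(2)[OF s, of "{v}"] by simp_all
  have "0 \<le> M"
    using M norm_ge_zero order.trans by blast
  \<comment> \<open>Distinct values in the range have distinct level sets, so the sum over values
    becomes a sum over a disjoint family of sets, to which the variation bound applies.\<close>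
  have inj: "inj_on (\<lambda>v. s -` {v}) (range s)"
    by (auto simp: inj_on_def)
  have "norm (simple_bint b \<mu> s) \<le> (\<Sum>v\<in>range s. norm (b v (\<mu> (s -` {v}))))"
    unfolding simple_bint_def by (rule norm_sum)
  also have "\<dots> \<le> (\<Sum>v\<in>range s. C * M * norm (\<mu> (s -` {v})))"
  proof (rule sum_mono)
    fix v assume "v \<in> range s"
    then have "norm v \<le> M" using M by auto
    then have "C * norm v * norm (\<mu> (s -` {v})) \<le> C * M * norm (\<mu> (s -` {v}))"
      using C(1) by (intro mult_right_mono mult_left_mono) auto
    then show "norm (b v (\<mu> (s -` {v}))) \<le> C * M * norm (\<mu> (s -` {v}))"
      using C(2) order.trans by blast
  qed
  also have "\<dots> = C * M * (\<Sum>A\<in>(\<lambda>v. s -` {v}) ` range s. norm (\<mu> A))"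
    by (simp add: sum.reindex[OF inj] sum_distrib_left)
  also have "\<dots> \<le> C * M * tvar \<mu>"
    using C(1) \<open>0 \<le> M\<close> fin meas
    by (intro mult_left_mono sum_norm_le_tvar[OF \<mu>]) (auto simp: disjoint_def)
  finally show ?thesis .
qed

lemma simple_bint_diff_le:
  assumes \<mu>: "\<mu> \<in> vmeas" and s: "simple_function borel s" "simple_function borel s'"
    and M: "\<And>w. dist (s w) (s' w) \<le> M"
    and C: "0 \<le> C" "\<And>v u. norm (b v u) \<le> C * norm v * norm u"
  shows "dist (simple_bint b \<mu> s) (simple_bint b \<mu> s') \<le> C * M * tvar \<mu>"
proof -
  have "vector_measure \<mu>" using \<mu> by (simp add: vmeas_def)
  have s'': "simple_function borel (\<lambda>w. (-1) *\<^sub>R s' w)"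
    using s(2) by (rule simple_function_compose1)
  have "simple_bint b \<mu> s - simple_bint b \<mu> s' = simple_bint b \<mu> (\<lambda>w. s w + (-1) *\<^sub>R s' w)"
    unfolding simple_bint_add[OF \<open>vector_measure \<mu>\<close> s(1) s'']
      simple_bint_scaleR[OF \<open>vector_measure \<mu>\<close> s(2)] by simp
  moreover have "norm \<dots> \<le> C * M * tvar \<mu>"
    using M simple_function_add[OF s(1) s''] C by (intro simple_bint_norm_le[OF \<mu>]) (auto simp: dist_norm)
  ultimately show ?thesis
    by (simp add: dist_norm)
qed

lemma nonneg_bound: obtains C where "0 \<le> C" "\<And>v u. norm (b v u) \<le> C * norm v * norm u"
proof -
  obtain K where "0 \<le> K" "\<And>v u. norm (b v u) \<le> norm v * norm u * K"
    using nonneg_bounded by blast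
  then show thesis
    by (intro that[of K]) (simp_all add: mult_ac)
qed

lemma simple_bint_uniformly_continuous:
  assumes \<mu>: "\<mu> \<in> vmeas" and e: "0 < e"
  obtains d where "0 < d" "\<And>s s'. simple_function borel s \<Longrightarrow> simple_function borel s' \<Longrightarrow>
    (\<And>w. dist (s w) (s' w) \<le> d) \<Longrightarrow> dist (simple_bint b \<mu> s) (simple_bint b \<mu> s') < e"
proof -
  obtain C where C: "0 \<le> C" "\<And>v u. norm (b v u) \<le> C * norm v * norm u"
    by (rule nonneg_bound) blast
  \<comment> \<open>The summand 1 avoids a zero denominator and makes
    \<open>C * d * tvar \<mu>\<close> strictly smaller than \<open>e\<close>.\<close>
  define d where "d = e / (C * tvar \<mu> + 1)"
  have pos: "0 < C * tvar \<mu> + 1" using C(1) by (simp add: add_nonneg_pos)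
  then have "0 < d" using e by (simp add: d_def)
  moreover have "C * d * tvar \<mu> < e"
  proof -
    have "C * d * tvar \<mu> < d * (C * tvar \<mu> + 1)"
      using \<open>0 < d\<close> by (simp add: algebra_simps)
    also have "\<dots> = e" using pos by (simp add: d_def)
    finally show ?thesis .
  qed
  ultimately show thesis
    by (intro that[of d]) (auto intro: order.strict_trans1[OF simple_bint_diff_le[OF \<mu> _ _ _ C]])
qed

text \<open>This gives the definite description in \<open>bint\<close> a value. Existence comes from
  uniform continuity of \<open>simple_bint\<close> and completeness; uniqueness holds because any
  two approximating sequences are eventually uniformly close to each other.\<close>

lemma simple_bint_tendsto:
  assumes \<mu>: "\<mu> \<in> vmeas" and s: "\<And>n. simple_function borel (s n)"
    and lim: "uniform_limit UNIV s g sequentially"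
  shows "(\<lambda>n. simple_bint b \<mu> (s n)) \<longlonglongrightarrow> bint b \<mu> g"
proof -
  have "Cauchy (\<lambda>n. simple_bint b \<mu> (s n))"
    unfolding Cauchy_def
  proof (intro allI impI)
    fix e :: real assume "0 < e"
    obtain d where "0 < d" and d: "\<And>s s'. simple_function borel s \<Longrightarrow> simple_function borel s' \<Longrightarrow>
      (\<And>w. dist (s w) (s' w) \<le> d) \<Longrightarrow> dist (simple_bint b \<mu> s) (simple_bint b \<mu> s') < e"
      by (rule simple_bint_uniformly_continuous[OF \<mu> \<open>0 < e\<close>]) blast
    obtain N where N: "\<And>n w. n \<ge> N \<Longrightarrow> dist (s n w) (g w) < d / 2"
      using lim \<open>0 < d\<close> unfolding uniform_limit_sequentially_iff by (metis UNIV_I half_gt_zero)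
    have "dist (s m w) (s n w) \<le> d" if "m \<ge> N" "n \<ge> N" for m n w
      using dist_triangle_half_l[OF N[OF that(1), of w] N[OF that(2), of w]] by simp
    then show "\<exists>M. \<forall>m\<ge>M. \<forall>n\<ge>M. dist (simple_bint b \<mu> (s m)) (simple_bint b \<mu> (s n)) < e"
      by (intro exI[of _ N] allI impI d s)
  qed
  then obtain I where I: "(\<lambda>n. simple_bint b \<mu> (s n)) \<longlonglongrightarrow> I"
    using Cauchy_convergent convergent_def by blast
  have unique: "I' = I"
    if s': "\<And>n. simple_function borel (s' n)" and lim': "uniform_limit UNIV s' g sequentially"
      and I': "(\<lambda>n. simple_bint b \<mu> (s' n)) \<longlonglongrightarrow> I'" for s' I'
  proof (rule LIMSEQ_unique[OF I'], rule Lim_transform[OF I])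
    show "(\<lambda>n. simple_bint b \<mu> (s' n) - simple_bint b \<mu> (s n)) \<longlonglongrightarrow> 0"
    proof (rule LIMSEQ_I)
      fix e :: real assume "0 < e"
      obtain d where "0 < d" and d: "\<And>s s'. simple_function borel s \<Longrightarrow> simple_function borel s' \<Longrightarrow>
        (\<And>w. dist (s w) (s' w) \<le> d) \<Longrightarrow> dist (simple_bint b \<mu> s) (simple_bint b \<mu> s') < e"
        by (rule simple_bint_uniformly_continuous[OF \<mu> \<open>0 < e\<close>]) blast
      obtain N where N: "\<And>n w. n \<ge> N \<Longrightarrow> dist (s n w) (g w) < d / 2"
        using lim \<open>0 < d\<close> unfolding uniform_limit_sequentially_iff by (metis UNIV_I half_gt_zero)
      obtain N' where N': "\<And>n w. n \<ge> N' \<Longrightarrow> dist (s' n w) (g w) < d / 2"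
        using lim' \<open>0 < d\<close> unfolding uniform_limit_sequentially_iff by (metis UNIV_I half_gt_zero)
      have "dist (s' n w) (s n w) \<le> d" if "n \<ge> max N N'" for n w
        using dist_triangle_half_l[OF N'[of n w] N[of n w]] that by simp
      then have "norm (simple_bint b \<mu> (s' n) - simple_bint b \<mu> (s n) - 0) < e" if "n \<ge> max N N'" for n
        using d[OF s' s] that by (simp add: dist_norm)
      then show "\<exists>N. \<forall>n\<ge>N. norm (simple_bint b \<mu> (s' n) - simple_bint b \<mu> (s n) - 0) < e" by blast
    qed
  qed
  have "bint b \<mu> g = I"
    unfolding bint_def using s lim I unique by (intro the_equality) blast+
  with I show ?thesis by simp
qed

lemma bint_simple:
  assumes "\<mu> \<in> vmeas" "simple_function borel s"
  shows "bint b \<mu> s = simple_bint b \<mu> s"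
  using simple_bint_tendsto[OF assms(1), of "\<lambda>_. s" s] assms(2)
  by (simp add: LIMSEQ_const_iff uniform_limit_const)

lemma bint_add:
  assumes \<mu>: "\<mu> \<in> vmeas" and "uniformly_simple g" "uniformly_simple h"
  shows "bint b \<mu> (\<lambda>w. g w + h w) = bint b \<mu> g + bint b \<mu> h"
proof -
  obtain s t where s: "\<And>n. simple_function borel (s n)" "uniform_limit UNIV s g sequentially"
    and t: "\<And>n. simple_function borel (t n)" "uniform_limit UNIV t h sequentially"
    using assms by (auto simp: uniformly_simple_def)
  have "(\<lambda>n. simple_bint b \<mu> (\<lambda>w. s n w + t n w)) \<longlonglongrightarrow> bint b \<mu> (\<lambda>w. g w + h w)"
    using s t by (intro simple_bint_tendsto[OF \<mu>] uniform_limit_add simple_function_add)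
  moreover have "(\<lambda>n. simple_bint b \<mu> (\<lambda>w. s n w + t n w)) \<longlonglongrightarrow> bint b \<mu> g + bint b \<mu> h"
    using \<mu> s t by (simp add: vmeas_def simple_bint_add) (intro tendsto_add simple_bint_tendsto[OF \<mu>])
  ultimately show ?thesis by (rule LIMSEQ_unique)
qed

lemma bint_scaleR:
  assumes \<mu>: "\<mu> \<in> vmeas" and "uniformly_simple g"
  shows "bint b \<mu> (\<lambda>w. r *\<^sub>R g w) = r *\<^sub>R bint b \<mu> g"
proof -
  obtain s where s: "\<And>n. simple_function borel (s n)" "uniform_limit UNIV s g sequentially"
    using assms by (auto simp: uniformly_simple_def)
  have "(\<lambda>n. simple_bint b \<mu> (\<lambda>w. r *\<^sub>R s n w)) \<longlonglongrightarrow> bint b \<mu> (\<lambda>w. r *\<^sub>R g w)"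
    using s by (intro simple_bint_tendsto[OF \<mu>] uniform_limit_scaleR_const)
      (rule simple_function_compose1)
  moreover have "(\<lambda>n. simple_bint b \<mu> (\<lambda>w. r *\<^sub>R s n w)) \<longlonglongrightarrow> r *\<^sub>R bint b \<mu> g"
    using \<mu> s by (simp add: vmeas_def simple_bint_scaleR)
      (intro tendsto_scaleR tendsto_const simple_bint_tendsto[OF \<mu>])
  ultimately show ?thesis by (rule LIMSEQ_unique)
qed

text \<open>Membership of the sum is a hypothesis because \<open>vmeas_add\<close> is stated for
  Hausdorff spaces, while the space here is an arbitrary topological one.\<close>

lemma bint_add_measure:
  assumes "\<mu> \<in> vmeas" "\<nu> \<in> vmeas" "\<mu> + \<nu> \<in> vmeas" "uniformly_simple g"
  shows "bint b (\<mu> + \<nu>) g = bint b \<mu> g + bint b \<nu> g"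
proof -
  obtain s where s: "\<And>n. simple_function borel (s n)" "uniform_limit UNIV s g sequentially"
    using assms by (auto simp: uniformly_simple_def)
  have "(\<lambda>n. simple_bint b (\<mu> + \<nu>) (s n)) \<longlonglongrightarrow> bint b \<mu> g + bint b \<nu> g"
    using tendsto_add[OF simple_bint_tendsto[OF assms(1) s] simple_bint_tendsto[OF assms(2) s]]
    by (simp add: simple_bint_def add_right sum.distrib)
  with simple_bint_tendsto[OF assms(3) s] show ?thesis by (rule LIMSEQ_unique)
qed

lemma bint_scaleR_measure:
  assumes "\<mu> \<in> vmeas" "uniformly_simple g"
  shows "bint b (r *\<^sub>R \<mu>) g = r *\<^sub>R bint b \<mu> g"
proof -
  obtain s where s: "\<And>n. simple_function borel (s n)" "uniform_limit UNIV s g sequentially"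
    using assms by (auto simp: uniformly_simple_def)
  have "(\<lambda>n. simple_bint b (r *\<^sub>R \<mu>) (s n)) \<longlonglongrightarrow> r *\<^sub>R bint b \<mu> g"
    using tendsto_scaleR[OF tendsto_const simple_bint_tendsto[OF assms(1) s], of r]
    by (simp add: simple_bint_def scaleR_right scaleR_sum_right)
  with simple_bint_tendsto[OF vmeas_scaleR[OF assms(1)] s] show ?thesis by (rule LIMSEQ_unique)
qed

text \<open>The approximants are bounded by \<open>M + inverse (real (Suc n))\<close>, so in the
  limit the constant \<open>C\<close> of \<open>b\<close> survives unchanged. The bound for the
  pairing of the function spaces rests on this.\<close>

lemma bint_norm_le:
  assumes \<mu>: "\<mu> \<in> vmeas" and g: "uniformly_simple g" and M: "\<And>w. norm (g w) \<le> M"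
    and C: "0 \<le> C" "\<And>v u. norm (b v u) \<le> C * norm v * norm u"
  shows "norm (bint b \<mu> g) \<le> C * M * tvar \<mu>"
proof -
  have "\<exists>s. simple_function borel s \<and> (\<forall>w. dist (s w) (g w) < inverse (real (Suc n)))" for n
    by (rule uniformly_simpleD[OF g, of "inverse (real (Suc n))"]) auto
  then obtain s where s: "\<And>n. simple_function borel (s n)"
    and close: "\<And>n w. dist (s n w) (g w) < inverse (real (Suc n))"
    by metis
  have "norm (simple_bint b \<mu> (s n)) \<le> C * (M + inverse (real (Suc n))) * tvar \<mu>" for n
  proof (rule simple_bint_norm_le[OF \<mu> s _ C])
    show "norm (s n w) \<le> M + inverse (real (Suc n))" for w
      using close[of n w] M[of w] norm_triangle_sub[of "s n w" "g w"] by (simp add: dist_norm)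
  qed
  moreover have "(\<lambda>n. C * (M + inverse (real (Suc n))) * tvar \<mu>) \<longlonglongrightarrow> C * (M + 0) * tvar \<mu>"
    by (intro tendsto_intros LIMSEQ_inverse_real_of_nat)
  moreover have "(\<lambda>n. norm (simple_bint b \<mu> (s n))) \<longlonglongrightarrow> norm (bint b \<mu> g)"
    by (intro tendsto_norm simple_bint_tendsto[OF \<mu> s] uniform_limit_inverse_Suc close)
  ultimately show ?thesis
    using LIMSEQ_le by fastforce
qed

lemma bint_diff_le:
  assumes \<mu>: "\<mu> \<in> vmeas" and g: "uniformly_simple g" "uniformly_simple h"
    and M: "\<And>w. dist (g w) (h w) \<le> M"
    and C: "0 \<le> C" "\<And>v u. norm (b v u) \<le> C * norm v * norm u"
  shows "dist (bint b \<mu> g) (bint b \<mu> h) \<le> C * M * tvar \<mu>"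
proof -
  note h' = uniformly_simple_scaleR[OF g(2), of "-1"]
  have "bint b \<mu> g - bint b \<mu> h = bint b \<mu> (\<lambda>w. g w + (-1) *\<^sub>R h w)"
    unfolding bint_add[OF \<mu> g(1) h'] bint_scaleR[OF \<mu> g(2)] by simp
  moreover have "norm \<dots> \<le> C * M * tvar \<mu>"
    using M by (intro bint_norm_le[OF \<mu> uniformly_simple_add[OF g(1) h'] _ C]) (simp add: dist_norm)
  ultimately show ?thesis
    by (simp add: dist_norm)
qed

text \<open>Here the approximants are themselves uniform limits of simple functions. This carries
  identities from \<open>int_Bd_pre\<close> over to its closure \<open>int_Bd\<close>.\<close>

lemma bint_tendsto:
  assumes \<mu>: "\<mu> \<in> vmeas" and g: "\<And>n. uniformly_simple (g n)"
    and lim: "uniform_limit UNIV g h sequentially"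
  shows "(\<lambda>n. bint b \<mu> (g n)) \<longlonglongrightarrow> bint b \<mu> h"
proof (rule metric_LIMSEQ_I)
  fix e :: real assume "0 < e"
  obtain C where C: "0 \<le> C" "\<And>v u. norm (b v u) \<le> C * norm v * norm u"
    by (rule nonneg_bound) blast
  define d where "d = e / (C * tvar \<mu> + 1)"
  have pos: "0 < C * tvar \<mu> + 1" using C(1) by (simp add: add_nonneg_pos)
  then have "0 < d" using \<open>0 < e\<close> by (simp add: d_def)
  then obtain N where N: "\<And>n w. n \<ge> N \<Longrightarrow> dist (g n w) (h w) \<le> d"
    using lim unfolding uniform_limit_sequentially_iff by (metis UNIV_I less_imp_le)
  have "dist (bint b \<mu> (g n)) (bint b \<mu> h) < e" if "n \<ge> N" for n
  proof -
    have "dist (bint b \<mu> (g n)) (bint b \<mu> h) \<le> C * d * tvar \<mu>"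
      using N[OF that] by (intro bint_diff_le[OF \<mu> g uniformly_simple_limit[OF g lim] _ C])
    also have "\<dots> < d * (C * tvar \<mu> + 1)"
      using \<open>0 < d\<close> by (simp add: algebra_simps)
    also have "\<dots> = e" using pos by (simp add: d_def)
    finally show ?thesis .
  qed
  then show "\<exists>N. \<forall>n\<ge>N. dist (bint b \<mu> (g n)) (bint b \<mu> h) < e" by blast
qed

end

interpretation scaleR_bint: banach_bilinear "scaleR :: real \<Rightarrow> 'u::banach \<Rightarrow> 'u"
  by (intro banach_bilinear.intro bounded_bilinear_scaleR)

section \<open>Kernels vanishing at infinity and exchange of integrals\<close>

text \<open>Provides the codes \<open>c\<close> and \<open>d\<close> of \<open>C0_approx\<close>.
  Adding one set to \<open>\<D>\<close> changes the recorded pattern by a case distinction along one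
  measurable set, whence the induction.\<close>

lemma simple_function_pattern:
  assumes "S \<in> sets M" "finite \<D>" "\<And>D. D \<in> \<D> \<Longrightarrow> U D \<in> sets M"
  shows "simple_function M (\<lambda>x. if x \<in> S then Some {D\<in>\<D>. x \<in> U D} else None)"
proof -
  have "simple_function M (\<lambda>x. {D\<in>\<D>. x \<in> U D})"
    using assms(2,3)
  proof (induction \<D>)
    case empty
    then show ?case by simp
  next
    case (insert D \<D>)
    have *: "{D'\<in>insert D \<D>. x \<in> U D'} = (if x \<in> U D then insert D {D\<in>\<D>. x \<in> U D} else {D\<in>\<D>. x \<in> U D})"
      for x by auto
    show ?case
      unfolding * using insert
      by (intro simple_function_If_set simple_function_compose1[where g = "insert D"])
        (auto simp: sets.Int_space_eq2)
  qed
  then show ?thesis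
    using assms(1)
    by (intro simple_function_If_set simple_function_compose1[where g = Some]) (auto simp: sets.Int_space_eq2)
qed

lemma C0_approx:
  fixes \<phi> :: "'x::t2_space \<times> 'w::t2_space \<Rightarrow> real"
  assumes "\<phi> \<in> C0" "0 < e"
  obtains c :: "'x \<Rightarrow> ('x set \<times> 'w set) set option" and d :: "'w \<Rightarrow> ('x set \<times> 'w set) set option" and a
  where "simple_function borel c" "simple_function borel d"
    "\<And>x w. \<bar>a (c x) (d w) - \<phi> (x, w)\<bar> < e"
proof -
  have cont: "continuous_on UNIV \<phi>"
    using assms by (simp add: C0_def)
  obtain S where S: "compact S" "\<And>z. z \<notin> S \<Longrightarrow> \<bar>\<phi> z\<bar> < e / 2"
    using assms half_gt_zero unfolding C0_def by blast
  \<comment> \<open>Open rectangles on which \<open>\<phi>\<close> oscillates by less than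
    \<open>e\<close>. By continuity they cover the whole product, so finitely many of them cover
    \<open>S\<close>.\<close>
  define \<R> where "\<R> = {D. open (fst D) \<and> open (snd D) \<and>
    (\<forall>y\<in>fst D \<times> snd D. \<forall>z\<in>fst D \<times> snd D. \<bar>\<phi> y - \<phi> z\<bar> < e)}"
  have cover: "z \<in> (\<Union>D\<in>\<R>. fst D \<times> snd D)" for z
  proof -
    have "open {y. \<bar>\<phi> y - \<phi> z\<bar> < e / 2}"
      using cont by (intro open_Collect_less continuous_intros) auto
    moreover have "z \<in> {y. \<bar>\<phi> y - \<phi> z\<bar> < e / 2}"
      using assms(2) by simp
    ultimately obtain U V where UV: "open U" "open V" "z \<in> U \<times> V"
      "U \<times> V \<subseteq> {y. \<bar>\<phi> y - \<phi> z\<bar> < e / 2}"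
      by (rule open_prod_elim)
    have "\<bar>\<phi> y - \<phi> y'\<bar> < e" if "y \<in> U \<times> V" "y' \<in> U \<times> V" for y y'
      using subsetD[OF UV(4) that(1)] subsetD[OF UV(4) that(2)]
      unfolding mem_Collect_eq by linarith
    then have "(U, V) \<in> \<R>"
      using UV by (simp add: \<R>_def)
    with UV(3) show ?thesis by force
  qed
  have "open (fst D \<times> snd D)" if "D \<in> \<R>" for D
    using that by (simp add: \<R>_def open_Times)
  moreover have "S \<subseteq> (\<Union>D\<in>\<R>. fst D \<times> snd D)"
    using cover by blast
  ultimately obtain \<D> where \<D>: "\<D> \<subseteq> \<R>" "finite \<D>" "S \<subseteq> (\<Union>D\<in>\<D>. fst D \<times> snd D)"
    by (rule compactE_image[OF S(1)]) blast+
  define c where "c x = (if x \<in> fst ` S then Some {D\<in>\<D>. x \<in> fst D} else None)" for x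
  define d where "d w = (if w \<in> snd ` S then Some {D\<in>\<D>. w \<in> snd D} else None)" for w
  \<comment> \<open>\<open>a\<close> evaluates \<open>\<phi>\<close> at some point with the
    prescribed codes. For codes that occur together, as \<open>c x\<close> and \<open>d w\<close> do
    at \<open>(x, w)\<close>, such a point exists.\<close>
  define a where "a s t = \<phi> (SOME z. c (fst z) = s \<and> d (snd z) = t)" for s t
  have "compact (fst ` S)" "compact (snd ` S)"
    using S(1) by (auto intro!: compact_continuous_image continuous_intros)
  then have "fst ` S \<in> sets borel" "snd ` S \<in> sets borel"
    by (auto intro: borel_closed compact_imp_closed)
  then have simple: "simple_function borel c" "simple_function borel d"
    unfolding c_def d_def using \<D>(1,2)
    by (auto intro!: simple_function_pattern simp: \<R>_def)
  \<comment> \<open>Only \<open>y\<close> is assumed to lie in \<open>S\<close>. Its codes are then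
    different from \<open>None\<close>, and a point with the same codes lies in every rectangle of
    \<open>\<D>\<close> that contains \<open>y\<close>; there is at least one.\<close>
  have osc: "\<bar>\<phi> y - \<phi> z\<bar> < e" if "y \<in> S" and eq: "c (fst y) = c (fst z)" "d (snd y) = d (snd z)" for y z
  proof -
    obtain D where D: "D \<in> \<D>" "y \<in> fst D \<times> snd D"
      using \<D>(3) \<open>y \<in> S\<close> by blast
    have "Some {D\<in>\<D>. fst y \<in> fst D} = c (fst z)" "Some {D\<in>\<D>. snd y \<in> snd D} = d (snd z)"
      using \<open>y \<in> S\<close> unfolding eq[symmetric] by (simp_all add: c_def d_def)
    then have "{D\<in>\<D>. fst y \<in> fst D} = {D\<in>\<D>. fst z \<in> fst D}" "{D\<in>\<D>. snd y \<in> snd D} = {D\<in>\<D>. snd z \<in> snd D}"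
      by (auto simp: c_def d_def split: if_splits)
    with D have "z \<in> fst D \<times> snd D"
      by (auto simp: mem_Times_iff)
    with D \<D>(1) show ?thesis
      by (auto simp: \<R>_def)
  qed
  have "\<bar>a (c x) (d w) - \<phi> (x, w)\<bar> < e" for x w
  proof -
    define z where "z = (SOME z. c (fst z) = c x \<and> d (snd z) = d w)"
    have z: "c (fst z) = c x" "d (snd z) = d w"
      unfolding z_def by (rule someI2[of _ "(x, w)"]; simp)+
    have "\<bar>\<phi> z - \<phi> (x, w)\<bar> < e"
    \<comment> \<open>If one of the two points is in \<open>S\<close>, it can serve as
      \<open>y\<close> in \<open>osc\<close>. If neither is, both values are below
      \<open>e / 2\<close> in modulus.\<close>
    proof (cases "z \<in> S \<or> (x, w) \<in> S")
      case True
      then show ?thesis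
        using osc[of z "(x, w)"] osc[of "(x, w)" z] z by (auto simp: abs_minus_commute)
    next
      case False
      then show ?thesis
        using S(2)[of z] S(2)[of "(x, w)"] by auto
    qed
    then show ?thesis
      by (simp add: a_def z_def)
  qed
  with simple show thesis by (rule that)
qed

lemma C0_bounded:
  assumes "\<phi> \<in> C0"
  obtains M where "0 \<le> M" "\<And>z. \<bar>\<phi> z\<bar> \<le> M"
proof -
  obtain S where S: "compact S" "\<And>z. z \<notin> S \<Longrightarrow> \<bar>\<phi> z\<bar> < 1"
    using assms zero_less_one unfolding C0_def by blast
  have "compact (\<phi> ` S)"
    using assms S(1) by (intro compact_continuous_image) (auto simp: C0_def intro: continuous_on_subset)
  then have "bounded (\<phi> ` S)"
    by (rule compact_imp_bounded)
  then obtain M where M: "\<And>z. z \<in> S \<Longrightarrow> \<bar>\<phi> z\<bar> \<le> M"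
    unfolding bounded_iff by auto
  have "\<bar>\<phi> z\<bar> \<le> max M 1" for z
    using S(2)[of z] M[of z] by fastforce
  then show thesis
    by (intro that[of "max M 1"]) auto
qed

lemma C0_swap:
  fixes \<phi> :: "'x::topological_space \<times> 'w::topological_space \<Rightarrow> real"
  assumes "\<phi> \<in> C0"
  shows "(\<lambda>z. \<phi> (prod.swap z)) \<in> C0"
proof -
  have "continuous_on UNIV (\<lambda>z. \<phi> (prod.swap z))"
    by (rule continuous_on_compose2[OF _ continuous_on_swap]) (use assms in \<open>auto simp: C0_def\<close>)
  moreover have "\<exists>S. compact S \<and> (\<forall>z. z \<notin> S \<longrightarrow> \<bar>\<phi> (prod.swap z)\<bar> < e)" if "0 < e" for e
  proof -
    obtain S where S: "compact S" "\<And>z. z \<notin> S \<Longrightarrow> \<bar>\<phi> z\<bar> < e"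
      using assms \<open>0 < e\<close> unfolding C0_def by blast
    have "compact (prod.swap ` S)"
      using continuous_on_swap S(1) by (rule compact_continuous_image)
    moreover have "\<bar>\<phi> (prod.swap z)\<bar> < e" if "z \<notin> prod.swap ` S" for z
    proof (rule S(2))
      show "prod.swap z \<notin> S"
        using that by (metis image_eqI swap_swap)
    qed
    ultimately show ?thesis by blast
  qed
  ultimately show ?thesis by (simp add: C0_def)
qed

text \<open>Together with \<open>C0_swap\<close> this transfers every fact about
  \<open>A_to_X\<close> to \<open>A_to_W\<close>.\<close>

lemma A_to_W_eq_A_to_X: "A_to_W \<phi> \<rho> = A_to_X (\<lambda>z. \<phi> (prod.swap z)) \<rho>"
  by (simp add: A_to_W_def A_to_X_def)

section \<open>The operator from measures to functions\<close>

context
  fixes \<phi> :: "'x::t2_space \<times> 'w::t2_space \<Rightarrow> real"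
  assumes \<phi>: "\<phi> \<in> C0"
begin

lemma uniformly_simple_section: "uniformly_simple (\<lambda>w. \<phi> (x, w))"
proof (rule uniformly_simpleI)
  fix e :: real assume "0 < e"
  obtain c :: "'x \<Rightarrow> ('x set \<times> 'w set) set option" and d :: "'w \<Rightarrow> ('x set \<times> 'w set) set option" and a
    where "simple_function borel d" "\<And>x w. \<bar>a (c x) (d w) - \<phi> (x, w)\<bar> < e"
    by (rule C0_approx[OF \<phi> \<open>0 < e\<close>]) blast
  then show "\<exists>s. simple_function borel s \<and> (\<forall>w. dist (s w) (\<phi> (x, w)) < e)"
    by (intro exI[of _ "\<lambda>w. a (c x) (d w)"]) (simp add: dist_norm simple_function_compose1)
qed

lemma A_to_X_add:
  fixes \<mu> \<nu> :: "'w set \<Rightarrow> 'u::banach"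
  assumes "\<mu> \<in> vmeas" "\<nu> \<in> vmeas"
  shows "A_to_X \<phi> (\<mu> + \<nu>) = A_to_X \<phi> \<mu> + A_to_X \<phi> \<nu>"
  unfolding A_to_X_def
  using assms by (simp add: fun_eq_iff scaleR_bint.bint_add_measure vmeas_add uniformly_simple_section)

lemma A_to_X_scaleR:
  fixes \<mu> :: "'w set \<Rightarrow> 'u::banach"
  assumes "\<mu> \<in> vmeas"
  shows "A_to_X \<phi> (r *\<^sub>R \<mu>) = r *\<^sub>R A_to_X \<phi> \<mu>"
  unfolding A_to_X_def
  using assms by (simp add: fun_eq_iff scaleR_bint.bint_scaleR_measure uniformly_simple_section)

lemma A_to_X_norm_le:
  fixes \<mu> :: "'w set \<Rightarrow> 'u::banach"
  assumes "\<mu> \<in> vmeas" "\<And>z. \<bar>\<phi> z\<bar> \<le> M"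
  shows "norm (A_to_X \<phi> \<mu> x) \<le> M * tvar \<mu>"
  unfolding A_to_X_def
  using scaleR_bint.bint_norm_le[OF assms(1) uniformly_simple_section, of x M 1] assms(2) by simp

text \<open>The approximant depends on \<open>x\<close> only through \<open>c x\<close>, so it is
  simple as soon as \<open>c\<close> is, and its error is the same for all \<open>x\<close>.\<close>

lemma A_to_X_approx:
  fixes \<mu> :: "'w set \<Rightarrow> 'u::banach"
  assumes \<mu>: "\<mu> \<in> vmeas" and d: "simple_function borel d"
    and a: "\<And>x w. \<bar>a (c x) (d w) - \<phi> (x, w)\<bar> < e"
  shows "dist (simple_bint scaleR \<mu> (\<lambda>w. a (c x) (d w))) (A_to_X \<phi> \<mu> x) \<le> e * tvar \<mu>"
proof -
  have s: "simple_function borel (\<lambda>w. a (c x) (d w))"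
    using d by (rule simple_function_compose1)
  have "dist (bint scaleR \<mu> (\<lambda>w. a (c x) (d w))) (A_to_X \<phi> \<mu> x) \<le> 1 * e * tvar \<mu>"
    unfolding A_to_X_def
    using a by (intro scaleR_bint.bint_diff_le[OF \<mu> simple_imp_uniformly_simple[OF s] uniformly_simple_section])
      (auto simp: dist_norm intro: less_imp_le)
  then show ?thesis
    using scaleR_bint.bint_simple[OF \<mu> s] by simp
qed

text \<open>Makes \<open>A_to_X \<phi> \<mu>\<close> a legitimate integrand for measures on the
  other space. The approximants come directly from those of the kernel.\<close>

lemma uniformly_simple_A_to_X:
  fixes \<mu> :: "'w set \<Rightarrow> 'u::banach"
  assumes \<mu>: "\<mu> \<in> vmeas"
  shows "uniformly_simple (A_to_X \<phi> \<mu>)"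
proof (rule uniformly_simpleI)
  fix e :: real assume "0 < e"
  have pos: "0 < tvar \<mu> + 1" by (simp add: add_nonneg_pos)
  then have "0 < e / (tvar \<mu> + 1)" using \<open>0 < e\<close> by simp
  then obtain c :: "'x \<Rightarrow> ('x set \<times> 'w set) set option" and d :: "'w \<Rightarrow> ('x set \<times> 'w set) set option" and a
    where cd: "simple_function borel c" "simple_function borel d"
      "\<And>x w. \<bar>a (c x) (d w) - \<phi> (x, w)\<bar> < e / (tvar \<mu> + 1)"
    by (rule C0_approx[OF \<phi>]) blast
  let ?s = "\<lambda>x. simple_bint scaleR \<mu> (\<lambda>w. a (c x) (d w))"
  have "simple_function borel ?s"
    using cd(1) by (rule simple_function_compose1)
  moreover have "dist (?s x) (A_to_X \<phi> \<mu> x) < e" for x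
  proof -
    have "dist (?s x) (A_to_X \<phi> \<mu> x) \<le> e / (tvar \<mu> + 1) * tvar \<mu>"
      by (rule A_to_X_approx[where a = a and c = c and d = d, OF \<mu> cd(2,3)])
    also have "\<dots> < e / (tvar \<mu> + 1) * (tvar \<mu> + 1)"
      using \<open>0 < e / (tvar \<mu> + 1)\<close> by (intro mult_strict_left_mono) auto
    also have "\<dots> = e" using pos by simp
    finally show ?thesis .
  qed
  ultimately show "\<exists>s. simple_function borel s \<and> (\<forall>x. dist (s x) (A_to_X \<phi> \<mu> x) < e)" by blast
qed

end

lemma uniformly_simple_A_to_W:
  fixes \<phi> :: "'x::t2_space \<times> 'w::t2_space \<Rightarrow> real" and \<rho> :: "'x set \<Rightarrow> 'v::banach"
  assumes "\<phi> \<in> C0" "\<rho> \<in> vmeas"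
  shows "uniformly_simple (A_to_W \<phi> \<rho>)"
  unfolding A_to_W_eq_A_to_X using assms by (intro uniformly_simple_A_to_X C0_swap)

section \<open>Exchange of the order of integration\<close>

context banach_bilinear
begin

lemma banach_bilinear_flip: "banach_bilinear (\<lambda>u v. b v u)"
  by (intro banach_bilinear.intro flip)

lemma bint_A_swap:
  fixes \<phi> :: "'x::t2_space \<times> 'w::t2_space \<Rightarrow> real"
  assumes \<phi>: "\<phi> \<in> C0" and \<mu>: "\<mu> \<in> vmeas" and \<rho>: "\<rho> \<in> vmeas"
  shows "bint b \<mu> (A_to_W \<phi> \<rho>) = bint (\<lambda>u v. b v u) \<rho> (A_to_X \<phi> \<mu>)"
    (is "?L = ?R")
proof -
  interpret flipped: banach_bilinear "\<lambda>u v. b v u"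
    by (rule banach_bilinear_flip)
  obtain C where C: "0 \<le> C" "\<And>v u. norm (b v u) \<le> C * norm v * norm u"
    by (rule nonneg_bound) blast
  then have C': "norm (b v u) \<le> C * norm u * norm v" for u v
    by (metis mult.assoc mult.commute)
  \<comment> \<open>Replacing \<open>\<phi>\<close> by its approximant costs at most
    \<open>C * e * tvar \<mu> * tvar \<rho>\<close> on each of the two sides.\<close>
  define K where "K = 2 * C * tvar \<mu> * tvar \<rho>"
  have vm: "vector_measure \<mu>" "vector_measure \<rho>"
    using \<mu> \<rho> by (simp_all add: vmeas_def)
  have "dist ?L ?R \<le> K * e" if "0 < e" for e
  proof -
    obtain c :: "'x \<Rightarrow> ('x set \<times> 'w set) set option" and d :: "'w \<Rightarrow> ('x set \<times> 'w set) set option" and a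
      where c: "simple_function borel c" and d: "simple_function borel d"
        and a: "\<And>x w. \<bar>a (c x) (d w) - \<phi> (x, w)\<bar> < e"
      by (rule C0_approx[OF \<phi> \<open>0 < e\<close>]) blast
    \<comment> \<open>Indexed by codes: \<open>s (d w)\<close> approximates
      \<open>A_to_W \<phi> \<rho> w\<close>, and \<open>t (c x)\<close> approximates
      \<open>A_to_X \<phi> \<mu> x\<close>.\<close>
    define s where "s j = simple_bint scaleR \<rho> (\<lambda>x. a (c x) j)" for j
    define t where "t i = simple_bint scaleR \<mu> (\<lambda>w. a i (d w))" for i
    have simple: "simple_function borel (\<lambda>w. s (d w))" "simple_function borel (\<lambda>x. t (c x))"
      by (rule simple_function_compose1[OF d], rule simple_function_compose1[OF c])
    have "dist ?L (bint b \<mu> (\<lambda>w. s (d w))) \<le> C * (e * tvar \<rho>) * tvar \<mu>"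
    proof (rule bint_diff_le[OF \<mu> uniformly_simple_A_to_W[OF \<phi> \<rho>] simple_imp_uniformly_simple[OF simple(1)] _ C])
      \<comment> \<open>For the swapped kernel \<open>d\<close> codes the free variable and
        \<open>c\<close> the integrated one, so the arguments of \<open>a\<close> are
        exchanged.\<close>
      show "dist (A_to_W \<phi> \<rho> w) (s (d w)) \<le> e * tvar \<rho>" for w
        using A_to_X_approx[OF C0_swap[OF \<phi>] \<rho> c, of "\<lambda>j i. a i j" d e w] a
        by (simp add: A_to_W_eq_A_to_X s_def dist_commute)
    qed
    moreover have "dist ?R (bint (\<lambda>u v. b v u) \<rho> (\<lambda>x. t (c x))) \<le> C * (e * tvar \<mu>) * tvar \<rho>"
    proof (rule flipped.bint_diff_le[OF \<rho> uniformly_simple_A_to_X[OF \<phi> \<mu>] simple_imp_uniformly_simple[OF simple(2)] _ C(1) C'])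
      show "dist (A_to_X \<phi> \<mu> x) (t (c x)) \<le> e * tvar \<mu>" for x
        using A_to_X_approx[where a = a and c = c and d = d and x = x, OF \<phi> \<mu> d a] by (simp add: t_def dist_commute)
    qed
    \<comment> \<open>For the approximants both sides are the same double sum over pairs of
      codes.\<close>
    moreover have "bint b \<mu> (\<lambda>w. s (d w)) = bint (\<lambda>u v. b v u) \<rho> (\<lambda>x. t (c x))"
    proof -
      have s: "s j = (\<Sum>i\<in>range c. a i j *\<^sub>R \<rho> (c -` {i}))" for j
        unfolding s_def by (rule scaleR_bint.simple_bint_compose[OF vm(2) c])
      have t: "t i = (\<Sum>j\<in>range d. a i j *\<^sub>R \<mu> (d -` {j}))" for i
        unfolding t_def by (rule scaleR_bint.simple_bint_compose[OF vm(1) d])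
      have "bint b \<mu> (\<lambda>w. s (d w)) = (\<Sum>j\<in>range d. b (s j) (\<mu> (d -` {j})))"
        by (simp add: bint_simple[OF \<mu> simple(1)] simple_bint_compose[OF vm(1) d])
      also have "\<dots> = (\<Sum>j\<in>range d. \<Sum>i\<in>range c. a i j *\<^sub>R b (\<rho> (c -` {i})) (\<mu> (d -` {j})))"
        by (simp add: s sum_left scaleR_left)
      also have "\<dots> = (\<Sum>i\<in>range c. \<Sum>j\<in>range d. a i j *\<^sub>R b (\<rho> (c -` {i})) (\<mu> (d -` {j})))"
        by (rule sum.swap)
      also have "\<dots> = (\<Sum>i\<in>range c. b (\<rho> (c -` {i})) (t i))"
        by (simp add: t sum_right scaleR_right)
      also have "\<dots> = bint (\<lambda>u v. b v u) \<rho> (\<lambda>x. t (c x))"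
        by (simp add: flipped.bint_simple[OF \<rho> simple(2)] flipped.simple_bint_compose[OF vm(2) c])
      finally show ?thesis .
    qed
    ultimately have "dist ?L (bint b \<mu> (\<lambda>w. s (d w))) + dist ?R (bint b \<mu> (\<lambda>w. s (d w)))
        \<le> C * (e * tvar \<rho>) * tvar \<mu> + C * (e * tvar \<mu>) * tvar \<rho>"
      by (intro add_mono) simp_all
    also have "\<dots> = K * e"
      by (simp add: K_def algebra_simps)
    finally show ?thesis
      by (rule order.trans[OF dist_triangle2])
  qed
  then have "dist ?L ?R \<le> K * inverse (real (Suc n))" for n
    by simp
  moreover have "(\<lambda>n. K * inverse (real (Suc n))) \<longlonglongrightarrow> K * 0"
    by (intro tendsto_intros LIMSEQ_inverse_real_of_nat)
  ultimately have "dist ?L ?R \<le> K * 0"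
    by (intro LIMSEQ_le_const) auto
  then show ?thesis by simp
qed

end

section \<open>Point masses\<close>

definition dirac :: "'w \<Rightarrow> 'u::zero \<Rightarrow> 'w set \<Rightarrow> 'u" where
  "dirac w u E = (if w \<in> E then u else 0)"

lemma variation_dirac_le: "variation (dirac w u) E \<le> (if w \<in> E then ennreal (norm u) else 0)"
proof (rule variation_least)
  fix P assume P: "finite P" "disjoint P" "\<Union>P = E"
  show "(\<Sum>A\<in>P. ennreal (norm (dirac w u A))) \<le> (if w \<in> E then ennreal (norm u) else 0)"
  proof (cases "w \<in> E")
    case True
    then obtain A where A: "A \<in> P" "w \<in> A" using P(3) by blast
    have "(\<Sum>A\<in>P. ennreal (norm (dirac w u A))) = (\<Sum>A\<in>{A}. ennreal (norm (dirac w u A)))"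
      using P A by (intro sum.mono_neutral_right) (auto simp: dirac_def disjoint_def)
    then show ?thesis using True A by (simp add: dirac_def)
  next
    case False
    then show ?thesis using P(3) by (auto simp: dirac_def intro!: sum.neutral)
  qed
qed

lemma dirac_vmeas:
  fixes w :: "'w::t2_space" and u :: "'u::banach"
  shows "dirac w u \<in> vmeas"
proof -
  have "vector_measure (dirac w u)"
    unfolding vector_measure_def
  proof (intro allI impI)
    fix A :: "nat \<Rightarrow> 'w set" assume A: "disjoint_family A"
    show "(\<lambda>n. dirac w u (A n)) sums dirac w u (\<Union>n. A n)"
    proof (cases "w \<in> (\<Union>n. A n)")
      case True
      then obtain i where i: "w \<in> A i" by blast
      have "dirac w u (A n) = (if n = i then u else 0)" for n
        using A i by (auto simp: dirac_def disjoint_family_on_def)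
      then show ?thesis
        using True sums_single[of i "\<lambda>_. u"] by (simp add: dirac_def)
    next
      case False
      then show ?thesis by (simp add: dirac_def)
    qed
  qed
  moreover have "variation (dirac w u) UNIV < \<infinity>"
    using variation_dirac_le[of w u UNIV] by (auto intro: order.strict_trans1)
  moreover have "regular_vmeas (dirac w u)"
    unfolding regular_vmeas_def
  proof (intro ballI allI impI)
    fix E :: "'w set" and e :: real assume "0 < e"
    \<comment> \<open>Chosen so that \<open>G - S\<close> misses \<open>w\<close> in either case;
      \<open>- {w}\<close> is open because points are closed.\<close>
    define S where "S = (if w \<in> E then {w} else {})"
    define G where "G = (if w \<in> E then UNIV else - {w})"
    have "variation (dirac w u) (G - S) \<le> 0"
      using variation_dirac_le[of w u "G - S"] by (simp add: S_def G_def split: if_splits)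
    then have "variation (dirac w u) (G - S) < ennreal e"
      using \<open>0 < e\<close> by simp
    moreover have "compact S" "open G" "S \<subseteq> E" "E \<subseteq> G"
      by (auto simp: S_def G_def)
    ultimately show "\<exists>S G. compact S \<and> open G \<and> S \<subseteq> E \<and> E \<subseteq> G \<and> variation (dirac w u) (G - S) < ennreal e"
      by blast
  qed
  ultimately show ?thesis by (simp add: vmeas_def)
qed

lemma (in banach_bilinear) bint_dirac:
  fixes w :: "'w::t2_space"
  assumes "uniformly_simple g"
  shows "bint b (dirac w u) g = b (g w) u"
proof -
  obtain s where s: "\<And>n. simple_function borel (s n)" and lim: "uniform_limit UNIV s g sequentially"
    using assms by (auto simp: uniformly_simple_def)
  have "simple_bint b (dirac w u) (s n) = b (s n w) u" for n
  proof -
    have "finite (range (s n))"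
      using simple_functionD(1)[OF s] by simp
    moreover have "b v (dirac w u (s n -` {v})) = (if s n w = v then b v u else 0)" for v
      by (simp add: dirac_def zero_right)
    ultimately show ?thesis
      by (simp add: simple_bint_def)
  qed
  then have "(\<lambda>n. b (s n w) u) \<longlonglongrightarrow> bint b (dirac w u) g"
    using simple_bint_tendsto[OF dirac_vmeas[of w u] s lim] by simp
  moreover have "(\<lambda>n. b (s n w) u) \<longlonglongrightarrow> b (g w) u"
    by (intro tendsto tendsto_const tendsto_uniform_limitI[OF lim]) simp
  ultimately show ?thesis by (rule LIMSEQ_unique)
qed

section \<open>Norms on function spaces and the Banach spaces of the pair\<close>

text \<open>One inequality suffices for homogeneity: the reverse one follows by applying it to
  \<open>inverse c\<close>, and the factor 0 gives \<open>N 0 = 0\<close>.\<close>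

lemma normed_onI:
  assumes E: "subspace E" and nonneg: "\<And>f. f \<in> E \<Longrightarrow> 0 \<le> N f"
    and zero: "\<And>f. f \<in> E \<Longrightarrow> N f = 0 \<Longrightarrow> f = 0"
    and scale: "\<And>c f. f \<in> E \<Longrightarrow> N (c *\<^sub>R f) \<le> \<bar>c\<bar> * N f"
    and triangle: "\<And>f g. f \<in> E \<Longrightarrow> g \<in> E \<Longrightarrow> N (f + g) \<le> N f + N g"
  shows "normed_on E N"
proof -
  have N0: "N 0 = 0"
    using scale[OF subspace_0[OF E], of 0] nonneg[OF subspace_0[OF E]] by simp
  have "N (c *\<^sub>R f) = \<bar>c\<bar> * N f" if "f \<in> E" for c f
  proof (cases "c = 0")
    case True
    then show ?thesis by (simp add: N0)
  next
    case False
    have "\<bar>c\<bar> * N f = \<bar>c\<bar> * N (inverse c *\<^sub>R (c *\<^sub>R f))"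
      using False by simp
    also have "\<dots> \<le> \<bar>c\<bar> * (\<bar>inverse c\<bar> * N (c *\<^sub>R f))"
      using that E by (intro mult_left_mono scale subspace_scale) auto
    also have "\<dots> = N (c *\<^sub>R f)"
      using False by (simp add: abs_inverse)
    finally show ?thesis
      using scale[OF that, of c] by simp
  qed
  then show ?thesis
    using assms N0 by (auto simp: normed_on_def)
qed

section \<open>Boundedness and continuity of bilinear forms\<close>

text \<open>With increments \<open>x = g' - g\<close> and \<open>y = f' - f\<close>, the difference
  of the values is \<open>p x y + p g y + p x f\<close>, and each of these terms is small with the
  increments.\<close>

lemma continuous_map_bilinear_on:
  assumes E: "normed_on E NE" and F: "normed_on F NF" and p: "bilinear_on F E p"
    and bound: "\<And>f g. f \<in> E \<Longrightarrow> g \<in> F \<Longrightarrow> \<bar>p g f\<bar> \<le> C * NF g * NE f"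
  shows "continuous_map (prod_topology (norm_topology F NF) (norm_topology E NE)) euclideanreal
    (\<lambda>(g, f). p g f)"
proof -
  interpret E: Metric_space E "norm_dist E NE" by (rule Metric_space_norm_dist[OF E])
  interpret F: Metric_space F "norm_dist F NF" by (rule Metric_space_norm_dist[OF F])
  have sub: "subspace E" "subspace F"
    using E F by (simp_all add: normed_on_def)
  have "\<exists>U. openin (prod_topology F.mtopology E.mtopology) U \<and> z \<in> U \<and>
      (\<forall>y\<in>U. (\<lambda>(g, f). p g f) y \<in> Met_TC.mball ((\<lambda>(g, f). p g f) z) e)"
    if "z \<in> topspace (prod_topology F.mtopology E.mtopology)" "0 < e" for z and e :: real
  proof -
    obtain g f where z: "z = (g, f)" "g \<in> F" "f \<in> E"
      using \<open>z \<in> topspace _\<close> by auto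
    \<comment> \<open>With both increments below \<open>r \<le> 1\<close> the three terms add up to
      at most \<open>r * (D - 1)\<close>. The modulus of \<open>C\<close> is taken since its sign is
      not known; the final 1 gives positivity and strictness.\<close>
    define D where "D = \<bar>C\<bar> * (1 + NE f + NF g) + 1"
    define r where "r = min 1 (e / D)"
    have nn: "0 \<le> NE f" "0 \<le> NF g"
      using z E F by (auto simp: normed_on_def)
    then have D: "0 < D" by (simp add: D_def add_nonneg_pos)
    then have r: "0 < r" "r \<le> 1" "r * D \<le> e"
      using \<open>0 < e\<close> by (auto simp: r_def min_def field_simps)
    have "\<bar>p g' f' - p g f\<bar> < e" if "g' \<in> F.mball g r" "f' \<in> E.mball f r" for g' f'
    proof -
      define x y where "x = g' - g" and "y = f' - f"
      have mem: "g' \<in> F" "f' \<in> E" "x \<in> F" "y \<in> E"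
        using that z sub by (auto simp: x_def y_def subspace_diff)
      have "norm_dist F NF g' g < r" "norm_dist E NE f' f < r"
        using that by (simp_all add: F.commute E.commute)
      then have small: "NF x < r" "NE y < r"
        using mem z by (simp_all add: norm_dist_def x_def y_def)
      have nn': "0 \<le> NF x" "0 \<le> NE y"
        using mem E F by (auto simp: normed_on_def)
      have add_left: "p (a + a') h = p a h + p a' h" if "a \<in> F" "a' \<in> F" "h \<in> E" for a a' h
        using p that unfolding bilinear_on_def by blast
      have add_right: "p a (h + h') = p a h + p a h'" if "a \<in> F" "h \<in> E" "h' \<in> E" for a h h'
        using p that unfolding bilinear_on_def by blast
      have "p g' f' = p (g + x) (f + y)"
        by (simp add: x_def y_def)
      also have "\<dots> = p g f + p g y + (p x f + p x y)"
        using z mem sub by (simp add: add_left add_right subspace_add)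
      finally have eq: "p g' f' - p g f = p x y + p g y + p x f" by simp
      have "\<bar>p x y\<bar> \<le> \<bar>C\<bar> * r" "\<bar>p g y\<bar> \<le> \<bar>C\<bar> * NF g * r" "\<bar>p x f\<bar> \<le> \<bar>C\<bar> * NE f * r"
      proof -
        have b: "\<bar>p a h\<bar> \<le> \<bar>C\<bar> * (NF a * NE h)" if "a \<in> F" "h \<in> E" for a h
        proof -
          have "0 \<le> NF a * NE h" using that E F by (auto simp: normed_on_def)
          then have "C * (NF a * NE h) \<le> \<bar>C\<bar> * (NF a * NE h)" by (intro mult_right_mono) auto
          with bound[OF that(2,1)] show ?thesis by (simp add: mult.assoc)
        qed
        have le: "NF x * NE y \<le> 1 * r" "NF g * NE y \<le> NF g * r" "NF x * NE f \<le> r * NE f"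
          using small nn nn' r by (intro mult_mono; simp)+
        have "\<bar>C\<bar> * (NF x * NE y) \<le> \<bar>C\<bar> * (1 * r)" "\<bar>C\<bar> * (NF g * NE y) \<le> \<bar>C\<bar> * (NF g * r)"
          "\<bar>C\<bar> * (NF x * NE f) \<le> \<bar>C\<bar> * (r * NE f)"
          by (intro mult_left_mono[OF le(1)] mult_left_mono[OF le(2)] mult_left_mono[OF le(3)] abs_ge_zero)+
        then show "\<bar>p x y\<bar> \<le> \<bar>C\<bar> * r" "\<bar>p g y\<bar> \<le> \<bar>C\<bar> * NF g * r" "\<bar>p x f\<bar> \<le> \<bar>C\<bar> * NE f * r"
          using b[OF mem(3,4)] b[OF z(2) mem(4)] b[OF mem(3) z(3)] by (simp_all add: mult_ac)
      qed
      then have "\<bar>p g' f' - p g f\<bar> \<le> \<bar>C\<bar> * r + \<bar>C\<bar> * NF g * r + \<bar>C\<bar> * NE f * r"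
        unfolding eq by linarith
      also have "\<dots> = r * D - r"
        by (simp add: D_def algebra_simps)
      finally show ?thesis
        using r by linarith
    qed
    then have "\<forall>y\<in>F.mball g r \<times> E.mball f r. (\<lambda>(g, f). p g f) y \<in> Met_TC.mball ((\<lambda>(g, f). p g f) z) e"
      by (auto simp: z(1) dist_real_def abs_minus_commute simp del: F.in_mball E.in_mball)
    moreover have "openin (prod_topology F.mtopology E.mtopology) (F.mball g r \<times> E.mball f r)"
      by (simp add: openin_prod_Times_iff)
    moreover have "z \<in> F.mball g r \<times> E.mball f r"
      using z r(1) by simp
    ultimately show ?thesis by blast
  qed
  then show ?thesis
    unfolding norm_topology_def Met_TC.continuous_map_to_metric[unfolded mtopology_is_euclidean] by blast
qed

text \<open>Continuity at the origin bounds \<open>p\<close> by 1 on a product of balls of radii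
  \<open>r\<close> and \<open>q\<close>; rescaling arbitrary vectors into these balls gives the
  constant \<open>inverse (r * q)\<close>.\<close>

lemma continuous_dual_pair_imp_banach_bilinear:
  fixes p :: "'v::banach \<Rightarrow> 'u::banach \<Rightarrow> real"
  assumes "continuous_dual_pair UNIV norm UNIV norm p"
  shows "banach_bilinear p"
proof -
  have p: "bilinear_on UNIV UNIV p"
    using assms by (simp add: continuous_dual_pair_def dual_pair_def)
  have add: "p (v + v') u = p v u + p v' u" "p v (u + u') = p v u + p v u'"
    and scale: "p (c *\<^sub>R v) u = c * p v u" "p v (c *\<^sub>R u) = c * p v u" for v v' u u' c
    using p by (simp_all add: bilinear_on_def)
  have "continuous_on UNIV (\<lambda>(v, u). p v u)"
    using assms by (simp add: continuous_dual_pair_def norm_topology_UNIV)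
  then have "open {z. \<bar>case z of (v, u) \<Rightarrow> p v u\<bar> < 1}"
    by (intro open_Collect_less continuous_intros)
  moreover have "(0, 0) \<in> {z. \<bar>case z of (v, u) \<Rightarrow> p v u\<bar> < 1}"
    using scale(1)[of 0 0 0] by simp
  ultimately obtain V U where VU: "open V" "open U" "(0, 0) \<in> V \<times> U"
    "V \<times> U \<subseteq> {z. \<bar>case z of (v, u) \<Rightarrow> p v u\<bar> < 1}"
    by (rule open_prod_elim)
  \<comment> \<open>Closed balls, since the rescaled vectors have norm exactly \<open>r\<close> and
    \<open>q\<close>.\<close>
  obtain r where r: "0 < r" "cball 0 r \<subseteq> V"
    using VU open_contains_cball by (metis mem_Times_iff fst_conv)
  obtain q where q: "0 < q" "cball 0 q \<subseteq> U"
    using VU open_contains_cball by (metis mem_Times_iff snd_conv)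
  have "\<bar>p v u\<bar> \<le> norm v * norm u * inverse (r * q)" for v u
  proof (cases "v = 0 \<or> u = 0")
    case True
    then show ?thesis
      using scale(1)[of 0 0 u] scale(2)[of v 0 0] by auto
  next
    case False
    then have pos: "0 < norm v" "0 < norm u" by auto
    have "(r / norm v) *\<^sub>R v \<in> V" "(q / norm u) *\<^sub>R u \<in> U"
      using pos r q by (auto intro!: subsetD[OF r(2)] subsetD[OF q(2)])
    then have "((r / norm v) *\<^sub>R v, (q / norm u) *\<^sub>R u) \<in> {z. \<bar>case z of (v, u) \<Rightarrow> p v u\<bar> < 1}"
      by (intro subsetD[OF VU(4)]) simp
    then have "\<bar>(q / norm u) * ((r / norm v) * p v u)\<bar> < 1"
      by (simp only: mem_Collect_eq prod.case scale)
    then have "(q / norm u) * (r / norm v) * \<bar>p v u\<bar> < 1"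
      using r(1) q(1) by (simp only: abs_mult abs_divide abs_norm_cancel abs_of_pos mult.assoc)
    moreover have "(q / norm u) * (r / norm v) * \<bar>p v u\<bar> = \<bar>p v u\<bar> * (r * q) / (norm v * norm u)"
      by (simp add: divide_inverse mult_ac)
    ultimately have "\<bar>p v u\<bar> * (r * q) < norm v * norm u"
      using pos by (simp only: divide_less_eq_1_pos mult_pos_pos)
    then have "\<bar>p v u\<bar> \<le> norm v * norm u / (r * q)"
      using r(1) q(1) by (subst pos_le_divide_eq) auto
    then show ?thesis
      by (simp only: divide_inverse)
  qed
  then show ?thesis
    by (intro banach_bilinear.intro bounded_bilinear.intro) (auto simp: add scale)
qed

section \<open>Function spaces with the supremum norm\<close>

text \<open>\<open>sup_norm\<close> is a supremum of reals and is meaningful for bounded functions.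
  Here a function of finite range lies within distance 1.\<close>

lemma uniformly_simple_bdd_above:
  assumes "uniformly_simple g"
  shows "bdd_above (range (\<lambda>w. norm (g w)))"
proof -
  obtain s where s: "simple_function borel s" "\<And>w. dist (s w) (g w) < 1"
    by (rule uniformly_simpleD[OF assms zero_less_one]) blast
  have "finite (range s)"
    using simple_functionD(1)[OF s(1)] by simp
  then have "bdd_above ((\<lambda>v. norm v + 1) ` range s)"
    by (rule bdd_above_finite[OF finite_imageI])
  then obtain M where M: "\<And>w. norm (s w) + 1 \<le> M"
    by (auto simp: bdd_above_def)
  have "norm (g w) \<le> M" for w
    using norm_triangle_sub[of "g w" "s w"] s(2)[of w] M[of w]
    by (simp add: dist_norm norm_minus_commute)
  then show ?thesis by (auto simp: bdd_above_def)
qed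

lemma sup_norm_le: "(\<And>w. norm (g w) \<le> M) \<Longrightarrow> sup_norm g \<le> M"
  unfolding sup_norm_def by (intro cSUP_least) auto

lemma norm_le_sup_norm: "bdd_above (range (\<lambda>w. norm (g w))) \<Longrightarrow> norm (g w) \<le> sup_norm g"
  unfolding sup_norm_def by (intro cSUP_upper) auto

lemma banach_on_sup_norm:
  fixes V :: "('w \<Rightarrow> 'v::banach) set"
  assumes V: "subspace V" and bdd: "\<And>g. g \<in> V \<Longrightarrow> bdd_above (range (\<lambda>w. norm (g w)))"
    and closed: "\<And>h g. (\<And>n::nat. h n \<in> V) \<Longrightarrow> uniform_limit UNIV h g sequentially \<Longrightarrow> g \<in> V"
  shows "banach_on V sup_norm"
proof -
  note upper = norm_le_sup_norm[OF bdd]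
  have N: "normed_on V sup_norm"
  proof (rule normed_onI[OF V])
    fix f assume f: "f \<in> V"
    show "0 \<le> sup_norm f"
      using upper[OF f] norm_ge_zero order.trans by blast
    show "f = 0" if "sup_norm f = 0"
      using upper[OF f] that by (simp add: fun_eq_iff)
    show "sup_norm (c *\<^sub>R f) \<le> \<bar>c\<bar> * sup_norm f" for c
      using upper[OF f] by (intro sup_norm_le) (simp add: mult_left_mono)
    show "sup_norm (f + g) \<le> sup_norm f + sup_norm g" if "g \<in> V" for g
      using upper[OF f] upper[OF that] by (intro sup_norm_le) (simp add: norm_triangle_mono)
  qed
  interpret Metric_space V "norm_dist V sup_norm"
    by (rule Metric_space_norm_dist[OF N])
  have "mcomplete"
    unfolding mcomplete_def
  proof (intro allI impI)
    fix \<sigma> assume "MCauchy \<sigma>"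
    then have \<sigma>: "\<And>n. \<sigma> n \<in> V"
      and Cauchy: "\<And>e. 0 < e \<Longrightarrow> \<exists>N. \<forall>n n'. N \<le> n \<longrightarrow> N \<le> n' \<longrightarrow> norm_dist V sup_norm (\<sigma> n) (\<sigma> n') < e"
      by (auto simp: MCauchy_def)
    have "uniformly_Cauchy_on UNIV \<sigma>"
    proof (rule uniformly_Cauchy_onI)
      fix e :: real assume "0 < e"
      then obtain N where N: "\<And>n n'. N \<le> n \<Longrightarrow> N \<le> n' \<Longrightarrow> norm_dist V sup_norm (\<sigma> n) (\<sigma> n') < e"
        using Cauchy by meson
      have "dist (\<sigma> m w) (\<sigma> n w) < e" if "m \<ge> N" "n \<ge> N" for m n w
        using N[OF that] upper[OF subspace_diff[OF V \<sigma> \<sigma>], of m n w] \<sigma>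
        by (simp add: norm_dist_def dist_norm fun_diff_def)
      then show "\<exists>M. \<forall>x\<in>UNIV. \<forall>m\<ge>M. \<forall>n\<ge>M. dist (\<sigma> m x) (\<sigma> n x) < e"
        by blast
    qed
    then have "uniformly_convergent_on UNIV \<sigma>"
      by (rule Cauchy_uniformly_convergent)
    then obtain g where lim: "uniform_limit UNIV \<sigma> g sequentially"
      unfolding uniformly_convergent_on_def by blast
    then have g: "g \<in> V"
      using closed \<sigma> by blast
    have "limitin mtopology \<sigma> g sequentially"
      unfolding limit_metric_sequentially
    proof (intro conjI allI impI g)
      fix e :: real assume "0 < e"
      then obtain N where N: "\<And>n w. N \<le> n \<Longrightarrow> dist (\<sigma> n w) (g w) < e / 2"
        using lim unfolding uniform_limit_sequentially_iff by (metis UNIV_I half_gt_zero)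
      have "norm_dist V sup_norm (\<sigma> n) g < e" if "N \<le> n" for n
      proof -
        have "sup_norm (\<sigma> n - g) \<le> e / 2"
          using N[OF that] by (intro sup_norm_le) (simp add: dist_norm less_imp_le)
        then show ?thesis
          using \<sigma> g \<open>0 < e\<close> by (simp add: norm_dist_def)
      qed
      then show "\<exists>N. \<forall>n\<ge>N. \<sigma> n \<in> V \<and> norm_dist V sup_norm (\<sigma> n) g < e"
        using \<sigma> by blast
    qed
    then show "\<exists>x. limitin mtopology \<sigma> x sequentially" by blast
  qed
  with N show ?thesis by (simp add: banach_on_def)
qed

lemma tvar_diff_le:
  fixes \<mu> \<nu> :: "'w::t2_space set \<Rightarrow> 'u::banach"
  assumes "\<mu> \<in> vmeas" "\<nu> \<in> vmeas"
  shows "tvar (\<mu> - \<nu>) \<le> tvar \<mu> + tvar \<nu>"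
  using tvar_add_le[OF assms(1) vmeas_scaleR[OF assms(2)], of "-1"] tvar_scaleR_le[OF assms(2), of "-1"]
  by simp

section \<open>The space \<open>int_B\<close> with its quotient norm\<close>

context
  fixes \<phi> :: "'x::t2_space \<times> 'w::t2_space \<Rightarrow> real"
  assumes \<phi>: "\<phi> \<in> C0"
begin

lemma A_to_X_diff:
  fixes \<mu> \<nu> :: "'w set \<Rightarrow> 'u::banach"
  assumes "\<mu> \<in> vmeas" "\<nu> \<in> vmeas"
  shows "A_to_X \<phi> (\<mu> - \<nu>) = A_to_X \<phi> \<mu> - A_to_X \<phi> \<nu>"
  using A_to_X_add[OF \<phi> subspace_diff[OF subspace_vmeas assms] assms(2)] by simp

lemma A_to_X_dirac: "A_to_X \<phi> (dirac w u) = (\<lambda>x. \<phi> (x, w) *\<^sub>R u)"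
  unfolding A_to_X_def by (simp add: scaleR_bint.bint_dirac uniformly_simple_section[OF \<phi>])

lemma subspace_int_B: "subspace (int_B \<phi> :: ('x \<Rightarrow> 'u::banach) set)"
proof (rule subspaceI)
  have "A_to_X \<phi> (0 *\<^sub>R 0) = 0 *\<^sub>R A_to_X \<phi> (0 :: 'w set \<Rightarrow> 'u)"
    by (rule A_to_X_scaleR[OF \<phi> vmeas_zero])
  then have "0 = A_to_X \<phi> (0 :: 'w set \<Rightarrow> 'u)"
    by simp
  then show "0 \<in> (int_B \<phi> :: ('x \<Rightarrow> 'u) set)"
    unfolding int_B_def using vmeas_zero by blast
  show "f + g \<in> int_B \<phi>" if "f \<in> int_B \<phi>" "g \<in> int_B \<phi>" for f g :: "'x \<Rightarrow> 'u"
    using that unfolding int_B_def by (auto simp flip: A_to_X_add[OF \<phi>] intro: vmeas_add)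
  show "c *\<^sub>R f \<in> int_B \<phi>" if "f \<in> int_B \<phi>" for c and f :: "'x \<Rightarrow> 'u"
    using that unfolding int_B_def by (auto simp flip: A_to_X_scaleR[OF \<phi>] intro: vmeas_scaleR)
qed

lemma int_norm_le:
  assumes "\<mu> \<in> vmeas"
  shows "int_norm \<phi> (A_to_X \<phi> \<mu>) \<le> tvar \<mu>"
  unfolding int_norm_def tvar_def[symmetric] using assms
  by (intro cInf_lower bdd_belowI[of _ 0]) auto

text \<open>The general way to bound something by the quotient norm: an estimate valid for every
  representing measure passes to the infimum. The proof divides by \<open>K\<close>; for
  \<open>K = 0\<close> any single representing measure gives \<open>r \<le> 0\<close>.\<close>

lemma le_mult_int_norm:
  assumes f: "f \<in> int_B \<phi>" and "0 \<le> K"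
    and le: "\<And>\<mu>. \<mu> \<in> vmeas \<Longrightarrow> f = A_to_X \<phi> \<mu> \<Longrightarrow> r \<le> K * tvar \<mu>"
  shows "r \<le> K * int_norm \<phi> f"
proof (cases "K = 0")
  case True
  then show ?thesis using f le by (auto simp: int_B_def)
next
  case False
  then have "0 < K" using \<open>0 \<le> K\<close> by simp
  have "r / K \<le> int_norm \<phi> f"
    unfolding int_norm_def tvar_def[symmetric] using f le \<open>0 < K\<close>
    by (intro cInf_greatest) (auto simp: int_B_def pos_divide_le_eq mult.commute)
  then show ?thesis using \<open>0 < K\<close> by (simp add: pos_divide_le_eq mult.commute)
qed

lemma int_norm_nonneg: "f \<in> int_B \<phi> \<Longrightarrow> 0 \<le> int_norm \<phi> f"
  using le_mult_int_norm[of f 1 0] by simp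

lemma int_norm_less:
  assumes "f \<in> int_B \<phi>" "int_norm \<phi> f < r"
  obtains \<mu> where "\<mu> \<in> vmeas" "f = A_to_X \<phi> \<mu>" "tvar \<mu> < r"
proof -
  have "\<exists>x\<in>{tvar \<mu> | \<mu>. \<mu> \<in> vmeas \<and> f = A_to_X \<phi> \<mu>}. x < r"
    using assms unfolding int_norm_def tvar_def[symmetric] by (intro cInf_lessD) (auto simp: int_B_def)
  then show thesis using that by blast
qed

text \<open>Point evaluations are bounded, uniformly in the point. This also yields definiteness of
  \<open>int_norm\<close>.\<close>

lemma norm_le_int_norm:
  assumes "\<And>z. \<bar>\<phi> z\<bar> \<le> M" "f \<in> int_B \<phi>"
  shows "norm (f x) \<le> M * int_norm \<phi> f"
proof -
  have "0 \<le> M" using assms(1) abs_ge_zero order.trans by blast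
  then show ?thesis
    using A_to_X_norm_le[OF \<phi> _ assms(1)] by (intro le_mult_int_norm[OF assms(2)]) auto
qed

lemma normed_on_int_B: "normed_on (int_B \<phi> :: ('x \<Rightarrow> 'u::banach) set) (int_norm \<phi>)"
proof (rule normed_onI[OF subspace_int_B])
  fix f :: "'x \<Rightarrow> 'u" assume f: "f \<in> int_B \<phi>"
  show "0 \<le> int_norm \<phi> f" by (rule int_norm_nonneg[OF f])
  show "f = 0" if "int_norm \<phi> f = 0"
  proof -
    obtain M where "\<And>z. \<bar>\<phi> z\<bar> \<le> M" by (rule C0_bounded[OF \<phi>]) blast
    then show ?thesis using norm_le_int_norm[OF _ f, of M] that by (simp add: fun_eq_iff)
  qed
  show "int_norm \<phi> (c *\<^sub>R f) \<le> \<bar>c\<bar> * int_norm \<phi> f" for c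
  proof (rule le_mult_int_norm[OF f])
    fix \<mu> :: "'w set \<Rightarrow> 'u" assume \<mu>: "\<mu> \<in> vmeas" "f = A_to_X \<phi> \<mu>"
    have "int_norm \<phi> (c *\<^sub>R f) \<le> tvar (c *\<^sub>R \<mu>)"
      unfolding \<mu>(2) A_to_X_scaleR[OF \<phi> \<mu>(1), symmetric] by (intro int_norm_le vmeas_scaleR \<mu>)
    also have "\<dots> \<le> \<bar>c\<bar> * tvar \<mu>" by (rule tvar_scaleR_le[OF \<mu>(1)])
    finally show "int_norm \<phi> (c *\<^sub>R f) \<le> \<bar>c\<bar> * tvar \<mu>" .
  qed simp
  show "int_norm \<phi> (f + g) \<le> int_norm \<phi> f + int_norm \<phi> g" if g: "g \<in> int_B \<phi>" for g
  proof -
    \<comment> \<open>The two infima are taken one after the other: first over the measures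
      representing \<open>f\<close> with \<open>\<nu>\<close> fixed, then over
      \<open>\<nu>\<close>.\<close>
    have "int_norm \<phi> (f + g) - tvar \<nu> \<le> 1 * int_norm \<phi> f" if \<nu>: "\<nu> \<in> vmeas" "g = A_to_X \<phi> \<nu>" for \<nu>
    proof (rule le_mult_int_norm[OF f])
      fix \<mu> :: "'w set \<Rightarrow> 'u" assume \<mu>: "\<mu> \<in> vmeas" "f = A_to_X \<phi> \<mu>"
      have "int_norm \<phi> (f + g) \<le> tvar (\<mu> + \<nu>)"
        unfolding \<mu>(2) \<nu>(2) A_to_X_add[OF \<phi> \<mu>(1) \<nu>(1), symmetric] by (intro int_norm_le vmeas_add \<mu> \<nu>)
      also have "\<dots> \<le> tvar \<mu> + tvar \<nu>" by (rule tvar_add_le[OF \<mu>(1) \<nu>(1)])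
      finally show "int_norm \<phi> (f + g) - tvar \<nu> \<le> 1 * tvar \<mu>" by simp
    qed simp
    then have "int_norm \<phi> (f + g) - int_norm \<phi> f \<le> 1 * int_norm \<phi> g"
      by (intro le_mult_int_norm[OF g]) (auto simp: algebra_simps)
    then show ?thesis by simp
  qed
qed

lemma banach_on_int_B: "banach_on (int_B \<phi> :: ('x \<Rightarrow> 'u::banach) set) (int_norm \<phi>)"
proof -
  let ?B = "int_B \<phi> :: ('x \<Rightarrow> 'u) set"
  let ?d = "norm_dist ?B (int_norm \<phi>)"
  interpret Metric_space ?B ?d
    by (rule Metric_space_norm_dist[OF normed_on_int_B])
  have "mcomplete"
    unfolding mcomplete_def
  proof (intro allI impI)
    fix \<sigma> assume "MCauchy \<sigma>"
    then have \<sigma>: "\<And>n. \<sigma> n \<in> ?B"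
      and Cauchy: "\<And>e. 0 < e \<Longrightarrow> \<exists>N. \<forall>m n. N \<le> m \<longrightarrow> N \<le> n \<longrightarrow> ?d (\<sigma> m) (\<sigma> n) < e"
      by (auto simp: MCauchy_def)
    have "\<forall>n. \<exists>N. \<forall>i j. N \<le> i \<longrightarrow> N \<le> j \<longrightarrow> ?d (\<sigma> i) (\<sigma> j) < (1/2) ^ n"
      using Cauchy by simp
    then obtain N where N: "\<And>n i j. N n \<le> i \<Longrightarrow> N n \<le> j \<Longrightarrow> ?d (\<sigma> i) (\<sigma> j) < (1/2) ^ n"
      by metis
    \<comment> \<open>Summing the indices, each raised by one, makes \<open>r\<close> strictly
      increasing and keeps \<open>N n \<le> r n\<close>.\<close>
    define r where "r n = (\<Sum>i\<le>n. Suc (N i))" for n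
    have "strict_mono r"
      unfolding strict_mono_Suc_iff by (simp add: r_def)
    have r_ge: "N n \<le> r n" for n
      using member_le_sum[of n "{..n}" "\<lambda>i. Suc (N i)"] by (simp add: r_def)
    \<comment> \<open>The strict bound on the quotient norm leaves room for a representing measure
      whose variation obeys the same bound.\<close>
    have "\<exists>\<nu>. \<nu> \<in> vmeas \<and> \<sigma> (r (Suc n)) - \<sigma> (r n) = A_to_X \<phi> \<nu> \<and> tvar \<nu> < (1/2) ^ n" for n
    proof -
      have "r n \<le> r (Suc n)" using \<open>strict_mono r\<close> by (simp add: strict_mono_leD)
      then have "?d (\<sigma> (r (Suc n))) (\<sigma> (r n)) < (1/2) ^ n"
        using r_ge[of n] by (intro N) auto
      then have "int_norm \<phi> (\<sigma> (r (Suc n)) - \<sigma> (r n)) < (1/2) ^ n"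
        using \<sigma> by (simp add: norm_dist_def)
      then show ?thesis
        using int_norm_less[OF subspace_diff[OF subspace_int_B \<sigma> \<sigma>]] by metis
    qed
    then obtain \<nu> where \<nu>: "\<And>n. \<nu> n \<in> vmeas" "\<And>n. \<sigma> (r (Suc n)) - \<sigma> (r n) = A_to_X \<phi> (\<nu> n)"
      "\<And>n. tvar (\<nu> n) < (1/2) ^ n"
      by metis
    obtain \<mu>0 where \<mu>0: "\<mu>0 \<in> vmeas" "\<sigma> (r 0) = A_to_X \<phi> \<mu>0"
      using \<sigma>[of "r 0"] by (auto simp: int_B_def)
    \<comment> \<open>Partial sums of the lifted differences; \<open>T n\<close> represents
      \<open>\<sigma> (r n)\<close>.\<close>
    define T where "T n = \<mu>0 + (\<Sum>k<n. \<nu> k)" for n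
    have T: "T n \<in> vmeas" for n
      unfolding T_def by (intro vmeas_add \<mu>0 subspace_sum[OF subspace_vmeas] \<nu>)
    have AT: "A_to_X \<phi> (T n) = \<sigma> (r n)" for n
    proof (induction n)
      case 0
      then show ?case by (simp add: T_def \<mu>0)
    next
      case (Suc n)
      have "T (Suc n) = T n + \<nu> n"
        by (simp add: T_def add.assoc)
      then have "A_to_X \<phi> (T (Suc n)) = A_to_X \<phi> (T n) + A_to_X \<phi> (\<nu> n)"
        by (simp add: A_to_X_add[OF \<phi> T \<nu>(1)])
      then show ?case
        by (simp add: Suc flip: \<nu>(2))
    qed
    \<comment> \<open>The closed form of the geometric sum; the subtracted term lets the induction
      close.\<close>
    have tail: "tvar (T (n + k) - T n) \<le> 2 * (1/2) ^ n - 2 * (1/2) ^ (n + k)" for n k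
    proof (induction k)
      case 0
      have "tvar (0 :: 'w set \<Rightarrow> 'u) = 0" by (simp add: tvar_def)
      then show ?case by (simp add: zero_fun_def)
    next
      case (Suc k)
      have "T (n + Suc k) - T n = (T (n + k) - T n) + \<nu> (n + k)"
        by (simp add: T_def add.assoc add_diff_eq)
      then have "tvar (T (n + Suc k) - T n) \<le> tvar (T (n + k) - T n) + tvar (\<nu> (n + k))"
        by (simp only: tvar_add_le[OF subspace_diff[OF subspace_vmeas T T] \<nu>(1)])
      then show ?case
        using Suc \<nu>(3)[of "n + k"] power_Suc[of "1/2 :: real" "n + k"] unfolding add_Suc_right by linarith
    qed
    have "\<exists>M. \<forall>m\<ge>M. \<forall>n\<ge>M. tvar (T m - T n) \<le> e" if "0 < e" for e
    proof -
      obtain M where M: "(1/2) ^ M < e / 4"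
        using real_arch_pow_inv[of "e / 4" "1/2"] \<open>0 < e\<close> by auto
      have le: "tvar (T m - T M) \<le> e / 2" if "M \<le> m" for m
      proof -
        have "tvar (T m - T M) \<le> 2 * (1/2) ^ M - 2 * (1/2) ^ m"
          using tail[of M "m - M"] that by simp
        also have "\<dots> \<le> 2 * (1/2) ^ M" by simp
        finally show ?thesis using M by simp
      qed
      have "tvar (T m - T n) \<le> e" if "M \<le> m" "M \<le> n" for m n
      proof -
        have "tvar (T m - T n) = tvar ((T m - T M) - (T n - T M))" by simp
        also have "\<dots> \<le> tvar (T m - T M) + tvar (T n - T M)"
          by (intro tvar_diff_le subspace_diff[OF subspace_vmeas] T)
        finally show ?thesis using le[OF that(1)] le[OF that(2)] by simp
      qed
      then show ?thesis by blast
    qed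
    then obtain \<mu> where \<mu>: "\<mu> \<in> vmeas" and lim: "(\<lambda>n. tvar (T n - \<mu>)) \<longlonglongrightarrow> 0"
      by (rule vmeas_complete[OF T]) blast+
    have A\<mu>: "A_to_X \<phi> \<mu> \<in> ?B"
      using \<mu> by (auto simp: int_B_def)
    have "?d (\<sigma> (r n)) (A_to_X \<phi> \<mu>) \<le> tvar (T n - \<mu>)" for n
    proof -
      have "?d (\<sigma> (r n)) (A_to_X \<phi> \<mu>) = int_norm \<phi> (A_to_X \<phi> (T n - \<mu>))"
        using \<sigma> A\<mu> by (simp add: norm_dist_def A_to_X_diff[OF T \<mu>] AT)
      then show ?thesis
        using int_norm_le[OF subspace_diff[OF subspace_vmeas T \<mu>]] by simp
    qed
    then have "(\<lambda>n. ?d ((\<sigma> \<circ> r) n) (A_to_X \<phi> \<mu>)) \<longlonglongrightarrow> 0"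
      by (intro tendsto_sandwich[OF _ _ tendsto_const lim]) auto
    \<comment> \<open>The operator does not increase norms, so the subsequence converges to the
      image of \<open>\<mu>\<close>; a Cauchy sequence follows its convergent subsequence.\<close>
    then have "limitin mtopology (\<sigma> \<circ> r) (A_to_X \<phi> \<mu>) sequentially"
      unfolding limitin_metric_dist_null using \<sigma> A\<mu> by simp
    then show "\<exists>x. limitin mtopology \<sigma> x sequentially"
      using MCauchy_convergent_subsequence[OF \<open>MCauchy \<sigma>\<close> \<open>strict_mono r\<close>] by blast
  qed
  with normed_on_int_B show ?thesis by (simp add: banach_on_def)
qed

end

section \<open>The space \<open>int_Bd\<close> as a closure\<close>

lemma int_Bd_pre_eq_int_B: "int_Bd_pre \<phi> = int_B (\<lambda>z. \<phi> (prod.swap z))"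
  by (simp add: int_Bd_pre_def int_B_def A_to_W_eq_A_to_X)

lemma int_Bd_pre_subset_int_Bd: "int_Bd_pre \<phi> \<subseteq> int_Bd \<phi>"
proof
  fix g assume "g \<in> int_Bd_pre \<phi>"
  then show "g \<in> int_Bd \<phi>"
    unfolding int_Bd_def by (auto intro!: exI[of _ "\<lambda>_. g"] uniform_limit_const)
qed

text \<open>\<open>int_Bd\<close> collects limits of sequences from \<open>int_Bd_pre\<close> only,
  so a limit of such limits needs a diagonal choice: for each \<open>n\<close> an element of
  \<open>int_Bd_pre\<close> within \<open>inverse (real (Suc n))\<close>.\<close>

lemma int_Bd_closed:
  assumes h: "\<And>n::nat. h n \<in> int_Bd \<phi>" and lim: "uniform_limit UNIV h g sequentially"
  shows "g \<in> int_Bd \<phi>"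
proof -
  have "\<exists>k. k \<in> int_Bd_pre \<phi> \<and> (\<forall>w. dist (k w) (g w) < inverse (real (Suc n)))" for n
  proof -
    let ?e = "inverse (real (Suc n)) / 2"
    have "0 < ?e" by simp
    then obtain m where m: "\<And>w. dist (h m w) (g w) < ?e"
      using lim unfolding uniform_limit_sequentially_iff by (metis UNIV_I order_refl)
    obtain k where k: "\<And>i. k i \<in> int_Bd_pre \<phi>" "uniform_limit UNIV k (h m) sequentially"
      using h[of m] by (auto simp: int_Bd_def)
    obtain i where i: "\<And>w. dist (k i w) (h m w) < ?e"
      using k(2) \<open>0 < ?e\<close> unfolding uniform_limit_sequentially_iff by (metis UNIV_I order_refl)
    have "dist (k i w) (g w) < inverse (real (Suc n))" for w
      using dist_triangle[of "k i w" "g w" "h m w"] m[of w] i[of w] by linarith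
    with k(1) show ?thesis by blast
  qed
  then obtain k where "\<And>n. k n \<in> int_Bd_pre \<phi>" "\<And>n w. dist (k n w) (g w) < inverse (real (Suc n))"
    by metis
  then show ?thesis
    unfolding int_Bd_def using uniform_limit_inverse_Suc by blast
qed

text \<open>Ensures that every element of the closure can be integrated against every
  measure.\<close>

lemma int_Bd_uniformly_simple:
  fixes \<phi> :: "'x::t2_space \<times> 'w::t2_space \<Rightarrow> real" and g :: "'w \<Rightarrow> 'v::banach"
  assumes "\<phi> \<in> C0" "g \<in> int_Bd \<phi>"
  shows "uniformly_simple g"
proof -
  obtain h where h: "\<And>n. h n \<in> int_Bd_pre \<phi>" "uniform_limit UNIV h g sequentially"
    using assms(2) by (auto simp: int_Bd_def)
  have "uniformly_simple (h n)" for n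
    using h(1)[of n] uniformly_simple_A_to_W[OF assms(1)] by (auto simp: int_Bd_pre_def)
  with h(2) show ?thesis by (blast intro: uniformly_simple_limit)
qed

lemma subspace_int_Bd:
  fixes \<phi> :: "'x::t2_space \<times> 'w::t2_space \<Rightarrow> real"
  assumes "\<phi> \<in> C0"
  shows "subspace (int_Bd \<phi> :: ('w \<Rightarrow> 'v::banach) set)"
proof (rule subspaceI)
  have pre: "subspace (int_Bd_pre \<phi> :: ('w \<Rightarrow> 'v) set)"
    unfolding int_Bd_pre_eq_int_B by (intro subspace_int_B C0_swap assms)
  show "0 \<in> (int_Bd \<phi> :: ('w \<Rightarrow> 'v) set)"
    using subspace_0[OF pre] int_Bd_pre_subset_int_Bd by blast
  show "f + g \<in> int_Bd \<phi>" if f: "f \<in> int_Bd \<phi>" and g: "g \<in> int_Bd \<phi>" for f g :: "'w \<Rightarrow> 'v"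
  proof -
    obtain h k where h: "\<And>n. h n \<in> int_Bd_pre \<phi>" "uniform_limit UNIV h f sequentially"
      and k: "\<And>n. k n \<in> int_Bd_pre \<phi>" "uniform_limit UNIV k g sequentially"
      using f g by (auto simp: int_Bd_def)
    have "uniform_limit UNIV (\<lambda>n. h n + k n) (f + g) sequentially"
      using uniform_limit_add[OF h(2) k(2)] by (simp add: plus_fun_def)
    moreover have "h n + k n \<in> int_Bd_pre \<phi>" for n
      by (intro subspace_add pre h k)
    ultimately show ?thesis
      unfolding int_Bd_def by (intro CollectI exI[of _ "\<lambda>n. h n + k n"]) simp
  qed
  show "c *\<^sub>R g \<in> int_Bd \<phi>" if g: "g \<in> int_Bd \<phi>" for c and g :: "'w \<Rightarrow> 'v"
  proof -
    obtain h where h: "\<And>n. h n \<in> int_Bd_pre \<phi>" "uniform_limit UNIV h g sequentially"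
      using g by (auto simp: int_Bd_def)
    have "uniform_limit UNIV (\<lambda>n. c *\<^sub>R h n) (c *\<^sub>R g) sequentially"
      using uniform_limit_scaleR_const[OF h(2)] by (simp add: scaleR_fun_def)
    then show ?thesis
      unfolding int_Bd_def using subspace_scale[OF pre h(1)]
      by (intro CollectI exI[of _ "\<lambda>n. c *\<^sub>R h n"]) simp
  qed
qed

lemma vv_rkbs_int_B:
  fixes \<phi> :: "'x::t2_space \<times> 'w::t2_space \<Rightarrow> real"
  assumes "\<phi> \<in> C0"
  shows "vv_rkbs (int_B \<phi> :: ('x \<Rightarrow> 'u::banach) set) (int_norm \<phi>)"
proof -
  obtain M where M: "0 \<le> M" "\<And>z. \<bar>\<phi> z\<bar> \<le> M" by (rule C0_bounded[OF assms]) blast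
  show ?thesis
    unfolding vv_rkbs_def
    by (intro conjI allI exI[of _ M] ballI banach_on_int_B[OF assms] norm_le_int_norm[OF assms] M)
qed

lemma vv_rkbs_int_Bd:
  fixes \<phi> :: "'x::t2_space \<times> 'w::t2_space \<Rightarrow> real"
  assumes "\<phi> \<in> C0"
  shows "vv_rkbs (int_Bd \<phi> :: ('w \<Rightarrow> 'v::banach) set) sup_norm"
proof -
  have bdd: "bdd_above (range (\<lambda>w. norm (g w)))" if "g \<in> int_Bd \<phi>" for g :: "'w \<Rightarrow> 'v"
    using int_Bd_uniformly_simple[OF assms that] by (rule uniformly_simple_bdd_above)
  have "banach_on (int_Bd \<phi> :: ('w \<Rightarrow> 'v) set) sup_norm"
    using bdd int_Bd_closed by (rule banach_on_sup_norm[OF subspace_int_Bd[OF assms]])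
  moreover have "norm (g w) \<le> 1 * sup_norm g" if "g \<in> int_Bd \<phi>" for g :: "'w \<Rightarrow> 'v" and w
    using norm_le_sup_norm[OF bdd[OF that]] by simp
  ultimately show ?thesis
    unfolding vv_rkbs_def by (intro conjI allI exI[of _ 1] ballI zero_le_one)
qed

lemma A_to_W_dirac:
  fixes \<phi> :: "'x::t2_space \<times> 'w::t2_space \<Rightarrow> real"
  assumes "\<phi> \<in> C0"
  shows "A_to_W \<phi> (dirac x v) = (\<lambda>w. \<phi> (x, w) *\<^sub>R v)"
  unfolding A_to_W_eq_A_to_X by (simp add: A_to_X_dirac[OF C0_swap[OF assms]])

lemma section_left_in_int_Bd:
  fixes \<phi> :: "'x::t2_space \<times> 'w::t2_space \<Rightarrow> real"
  assumes "\<phi> \<in> C0"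
  shows "(\<lambda>w. \<phi> (x, w) *\<^sub>R v) \<in> int_Bd \<phi>"
proof -
  have "(\<lambda>w. \<phi> (x, w) *\<^sub>R v) = A_to_W \<phi> (dirac x v)"
    by (simp add: A_to_W_dirac[OF assms])
  also have "\<dots> \<in> int_Bd_pre \<phi>"
    unfolding int_Bd_pre_def using dirac_vmeas[of x v] by blast
  finally show ?thesis
    using int_Bd_pre_subset_int_Bd by (rule rev_subsetD)
qed

lemma section_right_in_int_B:
  fixes \<phi> :: "'x::t2_space \<times> 'w::t2_space \<Rightarrow> real"
  assumes "\<phi> \<in> C0"
  shows "(\<lambda>x. \<phi> (x, w) *\<^sub>R u) \<in> int_B \<phi>"
proof -
  have "(\<lambda>x. \<phi> (x, w) *\<^sub>R u) = A_to_X \<phi> (dirac w u)"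
    by (simp add: A_to_X_dirac[OF assms])
  then show ?thesis
    unfolding int_B_def using dirac_vmeas[of w u] by blast
qed

lemma (in banach_bilinear) bint_cong_A_to_X:
  fixes \<phi> :: "'x::t2_space \<times> 'w::t2_space \<Rightarrow> real"
  assumes \<phi>: "\<phi> \<in> C0" and g: "g \<in> int_Bd \<phi>" and \<mu>: "\<mu> \<in> vmeas" and \<nu>: "\<nu> \<in> vmeas"
    and eq: "A_to_X \<phi> \<mu> = A_to_X \<phi> \<nu>"
  shows "bint b \<mu> g = bint b \<nu> g"
proof -
  obtain h where h: "\<And>n. h n \<in> int_Bd_pre \<phi>" and lim: "uniform_limit UNIV h g sequentially"
    using g by (auto simp: int_Bd_def)
  have "uniformly_simple (h n)" for n
    using h[of n] int_Bd_pre_subset_int_Bd by (intro int_Bd_uniformly_simple[OF \<phi>]) blast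
  note tendsto = bint_tendsto[OF _ this lim]
  have "bint b \<mu> (h n) = bint b \<nu> (h n)" for n
    using h[of n] bint_A_swap[OF \<phi> \<mu>] bint_A_swap[OF \<phi> \<nu>] eq by (auto simp: int_Bd_pre_def)
  then have "(\<lambda>n. bint b \<nu> (h n)) \<longlonglongrightarrow> bint b \<mu> g"
    using tendsto[OF \<mu>] by simp
  then show ?thesis
    using tendsto[OF \<nu>] by (rule LIMSEQ_unique)
qed

section \<open>The pairing of the two function spaces\<close>

context
  fixes \<phi> :: "'x::t2_space \<times> 'w::t2_space \<Rightarrow> real" and p :: "'v::banach \<Rightarrow> 'u::banach \<Rightarrow> real"
  assumes \<phi>: "\<phi> \<in> C0" and p: "banach_bilinear p"
begin

interpretation p: banach_bilinear p by (rule p)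

lemma int_pairing_eq:
  assumes "g \<in> int_Bd \<phi>" "\<mu> \<in> vmeas"
  shows "int_pairing \<phi> p g (A_to_X \<phi> \<mu>) = bint p \<mu> g"
  unfolding int_pairing_def
proof (rule the_equality)
  show "\<forall>\<nu>\<in>vmeas. A_to_X \<phi> \<mu> = A_to_X \<phi> \<nu> \<longrightarrow> bint p \<mu> g = bint p \<nu> g"
    using p.bint_cong_A_to_X[OF \<phi> assms(1,2)] by blast
qed (use assms(2) in blast)

lemma int_pairing_le:
  assumes "0 \<le> C" "\<And>v u. \<bar>p v u\<bar> \<le> C * norm v * norm u"
    and f: "f \<in> int_B \<phi>" and g: "g \<in> int_Bd \<phi>"
  shows "\<bar>int_pairing \<phi> p g f\<bar> \<le> C * sup_norm g * int_norm \<phi> f"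
proof (rule le_mult_int_norm[OF \<phi> f])
  note us = int_Bd_uniformly_simple[OF \<phi> g]
  note upper = norm_le_sup_norm[OF uniformly_simple_bdd_above[OF us]]
  show "0 \<le> C * sup_norm g"
    using assms(1) order.trans[OF norm_ge_zero upper] by simp
  fix \<mu> :: "'w set \<Rightarrow> 'u" assume "\<mu> \<in> vmeas" "f = A_to_X \<phi> \<mu>"
  then show "\<bar>int_pairing \<phi> p g f\<bar> \<le> C * sup_norm g * tvar \<mu>"
    using p.bint_norm_le[OF _ us upper assms(1)] assms(2) by (simp add: int_pairing_eq[OF g])
qed

text \<open>In the first argument this is linearity of the integral. In the second, sums and
  multiples of representing measures represent the sums and multiples of the functions.\<close>

lemma bilinear_on_int_pairing: "bilinear_on (int_Bd \<phi>) (int_B \<phi>) (int_pairing \<phi> p)"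
  unfolding bilinear_on_def
proof (intro conjI ballI allI)
  fix g g' :: "'w \<Rightarrow> 'v" and f f' :: "'x \<Rightarrow> 'u" and c :: real
  assume g: "g \<in> int_Bd \<phi>" and "f \<in> int_B \<phi>"
  then obtain \<mu> where \<mu>: "\<mu> \<in> vmeas" "f = A_to_X \<phi> \<mu>"
    by (auto simp: int_B_def)
  note us = int_Bd_uniformly_simple[OF \<phi>]
  show "int_pairing \<phi> p (g + g') f = int_pairing \<phi> p g f + int_pairing \<phi> p g' f" if "g' \<in> int_Bd \<phi>"
    using p.bint_add[OF \<mu>(1) us[OF g] us[OF that]] subspace_add[OF subspace_int_Bd[OF \<phi>] g that] g that \<mu>
    by (simp add: int_pairing_eq plus_fun_def)
  show "int_pairing \<phi> p (c *\<^sub>R g) f = c * int_pairing \<phi> p g f"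
    using p.bint_scaleR[OF \<mu>(1) us[OF g]] subspace_scale[OF subspace_int_Bd[OF \<phi>] g] g \<mu>
    by (simp add: int_pairing_eq scaleR_fun_def)
  show "int_pairing \<phi> p g (c *\<^sub>R f) = c * int_pairing \<phi> p g f"
    using p.bint_scaleR_measure[OF \<mu>(1) us[OF g]] vmeas_scaleR[OF \<mu>(1)] g \<mu>
    by (simp add: int_pairing_eq flip: A_to_X_scaleR[OF \<phi>])
  show "int_pairing \<phi> p g (f + f') = int_pairing \<phi> p g f + int_pairing \<phi> p g f'" if "f' \<in> int_B \<phi>"
  proof -
    obtain \<nu> where \<nu>: "\<nu> \<in> vmeas" "f' = A_to_X \<phi> \<nu>"
      using \<open>f' \<in> int_B \<phi>\<close> by (auto simp: int_B_def)
    show ?thesis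
      using p.bint_add_measure[OF \<mu>(1) \<nu>(1) vmeas_add[OF \<mu>(1) \<nu>(1)] us[OF g]] vmeas_add[OF \<mu>(1) \<nu>(1)] g \<mu> \<nu>
      by (simp add: int_pairing_eq flip: A_to_X_add[OF \<phi>])
  qed
qed

text \<open>The section is the image of a point mass at \<open>x\<close>. Exchanging the integrals
  turns the pairing into the integral of \<open>f\<close> against this mass, an evaluation at
  \<open>x\<close>.\<close>

lemma int_pairing_section_left:
  assumes "f \<in> int_B \<phi>"
  shows "int_pairing \<phi> p (\<lambda>w. \<phi> (x, w) *\<^sub>R v) f = p v (f x)"
proof -
  interpret flipped: banach_bilinear "\<lambda>u v. p v u"
    by (rule p.banach_bilinear_flip)
  obtain \<mu> where \<mu>: "\<mu> \<in> vmeas" "f = A_to_X \<phi> \<mu>"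
    using assms by (auto simp: int_B_def)
  have "int_pairing \<phi> p (\<lambda>w. \<phi> (x, w) *\<^sub>R v) f = bint p \<mu> (A_to_W \<phi> (dirac x v))"
    by (simp add: \<mu> int_pairing_eq section_left_in_int_Bd[OF \<phi>] A_to_W_dirac[OF \<phi>])
  also have "\<dots> = bint (\<lambda>u v. p v u) (dirac x v) f"
    unfolding \<mu>(2) by (rule p.bint_A_swap[OF \<phi> \<mu>(1) dirac_vmeas])
  also have "\<dots> = p v (f x)"
    unfolding \<mu>(2) by (rule flipped.bint_dirac[OF uniformly_simple_A_to_X[OF \<phi> \<mu>(1)]])
  finally show ?thesis .
qed

text \<open>The second argument is represented by a point mass at \<open>w\<close>, so the pairing
  is directly an evaluation at \<open>w\<close>.\<close>

lemma int_pairing_section_right: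
  assumes "g \<in> int_Bd \<phi>"
  shows "int_pairing \<phi> p g (\<lambda>x. \<phi> (x, w) *\<^sub>R u) = p (g w) u"
  using int_pairing_eq[OF assms dirac_vmeas] p.bint_dirac[OF int_Bd_uniformly_simple[OF \<phi> assms]]
  by (simp add: A_to_X_dirac[OF \<phi>])

end

section \<open>Operators belonging to the kernel\<close>

lemma twin_U_scaled:
  assumes "dual_pair UNIV norm UNIV norm p"
  shows "twin_U p (\<lambda>v u. c * p v u) = (\<lambda>u. c *\<^sub>R u)"
  unfolding twin_U_def
proof (rule the_equality)
  have p: "bilinear_on UNIV UNIV p" and sep: "\<And>u. (\<forall>v. p v u = 0) \<Longrightarrow> u = 0"
    using assms by (simp_all add: dual_pair_def)
  have scale: "p v (c *\<^sub>R u) = c * p v u" for v u c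
    using p by (simp add: bilinear_on_def)
  have add: "p v (u + u') = p v u + p v u'" for v u u'
    using p by (simp add: bilinear_on_def)
  have diff: "p v (u - u') = p v u - p v u'" for v u u'
    using add[of v "u - u'" u'] by simp
  show "linear (\<lambda>u. c *\<^sub>R u) \<and> (\<forall>v u. p v (c *\<^sub>R u) = c * p v u)"
    by (simp add: scale)
  fix T assume "linear T \<and> (\<forall>v u. p v (T u) = c * p v u)"
  \<comment> \<open>Uniqueness of the operator comes from the separation of points by the
    pairing.\<close>
  then have "p v (T u - c *\<^sub>R u) = 0" for v u
    by (simp add: diff scale)
  then have "T u - c *\<^sub>R u = 0" for u
    by (intro sep) simp
  then show "T = (\<lambda>u. c *\<^sub>R u)"
    by (simp add: fun_eq_iff)
qed

lemma twin_Ud_scaled: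
  assumes "dual_pair UNIV norm UNIV norm p"
  shows "twin_Ud p (\<lambda>v u. c * p v u) = (\<lambda>v. c *\<^sub>R v)"
  unfolding twin_Ud_def
proof (rule the_equality)
  have p: "bilinear_on UNIV UNIV p" and sep: "\<And>v. (\<forall>u. p v u = 0) \<Longrightarrow> v = 0"
    using assms by (simp_all add: dual_pair_def)
  have scale: "p (c *\<^sub>R v) u = c * p v u" for v u c
    using p by (simp add: bilinear_on_def)
  have add: "p (v + v') u = p v u + p v' u" for v v' u
    using p by (simp add: bilinear_on_def)
  have diff: "p (v - v') u = p v u - p v' u" for v v' u
    using add[of "v - v'" v' u] by simp
  show "linear (\<lambda>v. c *\<^sub>R v) \<and> (\<forall>v u. p (c *\<^sub>R v) u = c * p v u)"
    by (simp add: scale)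
  fix T assume "linear T \<and> (\<forall>v u. p (T v) u = c * p v u)"
  then have "p (T v - c *\<^sub>R v) u = 0" for v u
    by (simp add: diff scale)
  then have "T v - c *\<^sub>R v = 0" for v
    by (intro sep) simp
  then show "T = (\<lambda>v. c *\<^sub>R v)"
    by (simp add: fun_eq_iff)
qed

lemma scaled_in_twin:
  fixes p :: "'v::banach \<Rightarrow> 'u::banach \<Rightarrow> real"
  assumes "banach_bilinear p"
  shows "(\<lambda>v u. c * p v u) \<in> twin p"
proof -
  interpret p: banach_bilinear p by (rule assms)
  have "bounded_bilinear (\<lambda>v u. c * p v u)"
    using bounded_bilinear.comp[OF p.bounded_bilinear_axioms bounded_linear_scaleR_right bounded_linear_ident, of c]
    by (simp add: p.scaleR_left)
  then show ?thesis
    unfolding twin_def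
    by (intro CollectI conjI exI[of _ "\<lambda>u. c *\<^sub>R u"] exI[of _ "\<lambda>v. c *\<^sub>R v"])
      (simp_all add: p.scaleR_left p.scaleR_right)
qed

section \<open>Assembly of the adjoint pair\<close>

theorem theorem4p2:
  fixes \<phi> :: "'x::t2_space \<times> 'w::t2_space \<Rightarrow> real"
    and p :: "'v::banach \<Rightarrow> 'u::banach \<Rightarrow> real"
  assumes "locally_compact_space (euclidean :: 'x topology)"
    and "locally_compact_space (euclidean :: 'w topology)"
    and "\<phi> \<in> C0"
    and "continuous_dual_pair UNIV norm UNIV norm p"
  shows "adjoint_pair p (int_B \<phi>) (int_norm \<phi>) (int_Bd \<phi>) sup_norm
           (int_pairing \<phi> p) (int_kernel \<phi> p) \<and>
         (\<forall>C>0. (\<forall>v u. \<bar>p v u\<bar> \<le> C * norm v * norm u) \<longrightarrow>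
            (\<forall>C'. (\<forall>v u. \<bar>p v u\<bar> \<le> C' * norm v * norm u) \<longrightarrow> C \<le> C') \<longrightarrow>
            (\<forall>f\<in>int_B \<phi>. \<forall>g\<in>int_Bd \<phi>.
               \<bar>int_pairing \<phi> p g f\<bar> \<le> C * sup_norm g * int_norm \<phi> f))"
proof
  let ?B = "int_B \<phi> :: ('x \<Rightarrow> 'u) set" and ?Bd = "int_Bd \<phi> :: ('w \<Rightarrow> 'v) set"
  note \<phi> = \<open>\<phi> \<in> C0\<close>
  have bb: "banach_bilinear p"
    using assms(4) by (rule continuous_dual_pair_imp_banach_bilinear)
  interpret p: banach_bilinear p by (rule bb)
  have dual: "dual_pair UNIV norm UNIV norm p"
    using assms(4) by (simp add: continuous_dual_pair_def)
  have sep: "(\<forall>v. p v u = 0) \<Longrightarrow> u = 0" "(\<forall>u. p v u = 0) \<Longrightarrow> v = 0" for u v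
    using dual by (auto simp: dual_pair_def)
  note B = vv_rkbs_int_B[OF \<phi>, where 'u = 'u] and Bd = vv_rkbs_int_Bd[OF \<phi>, where 'v = 'v]
  note bound = int_pairing_le[OF \<phi> bb]
  note left = int_pairing_section_left[OF \<phi> bb] section_left_in_int_Bd[OF \<phi>]
  note right = int_pairing_section_right[OF \<phi> bb] section_right_in_int_B[OF \<phi>]
  have K: "int_kernel \<phi> p x w = (\<lambda>v u. \<phi> (x, w) * p v u)" for x w
    by (simp add: int_kernel_def fun_eq_iff)
  have banach: "banach_on ?B (int_norm \<phi>)" "banach_on ?Bd sup_norm"
    using B Bd by (simp_all add: vv_rkbs_def)
  \<comment> \<open>Non-degeneracy follows from the reproducing properties: testing against sections
    of the kernel recovers \<open>p v (f x)\<close> and, below, \<open>p (g w) u\<close>, and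
    \<open>p\<close> separates points.\<close>
  have "f = 0" if f: "f \<in> ?B" and zero: "\<forall>g\<in>?Bd. int_pairing \<phi> p g f = 0" for f
  proof
    fix x
    have "p v (f x) = 0" for v
      using zero left(2)[of x v] left(1)[OF f, of x v] by simp
    then show "f x = 0 x" using sep(1) by simp
  qed
  moreover have "g = 0" if g: "g \<in> ?Bd" and zero: "\<forall>f\<in>?B. int_pairing \<phi> p g f = 0" for g
  proof
    fix w
    have "p (g w) u = 0" for u
      using zero right(2)[of w u] right(1)[OF g, of w u] by simp
    then show "g w = 0 w" using sep(2) by simp
  qed
  ultimately have dual': "dual_pair ?B (int_norm \<phi>) ?Bd sup_norm (int_pairing \<phi> p)"
    unfolding dual_pair_def by (intro conjI ballI impI banach bilinear_on_int_pairing[OF \<phi> bb])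
  \<comment> \<open>For continuity of the pairing any bound of \<open>p\<close> will do.\<close>
  obtain C where C: "0 \<le> C" "\<And>v u. \<bar>p v u\<bar> \<le> C * norm v * norm u"
    by (rule p.nonneg_bound[unfolded real_norm_def]) blast
  have "normed_on ?B (int_norm \<phi>)" "normed_on ?Bd sup_norm"
    using banach by (simp_all add: banach_on_def)
  then have "continuous_map (prod_topology (norm_topology ?Bd sup_norm) (norm_topology ?B (int_norm \<phi>)))
      euclideanreal (\<lambda>(g, f). int_pairing \<phi> p g f)"
    using bilinear_on_int_pairing[OF \<phi> bb] bound[OF C] by (rule continuous_map_bilinear_on)
  with dual' have "continuous_dual_pair ?B (int_norm \<phi>) ?Bd sup_norm (int_pairing \<phi> p)"
    by (simp add: continuous_dual_pair_def)
  then show "adjoint_pair p ?B (int_norm \<phi>) ?Bd sup_norm (int_pairing \<phi> p) (int_kernel \<phi> p)"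
    unfolding adjoint_pair_def K twin_U_scaled[OF dual] twin_Ud_scaled[OF dual]
    using dual B Bd scaled_in_twin[OF bb] left right by simp (intro conjI allI left right)
  show "\<forall>C>0. (\<forall>v u. \<bar>p v u\<bar> \<le> C * norm v * norm u) \<longrightarrow>
      (\<forall>C'. (\<forall>v u. \<bar>p v u\<bar> \<le> C' * norm v * norm u) \<longrightarrow> C \<le> C') \<longrightarrow>
      (\<forall>f\<in>?B. \<forall>g\<in>?Bd. \<bar>int_pairing \<phi> p g f\<bar> \<le> C * sup_norm g * int_norm \<phi> f)"
    by (intro allI impI ballI bound) auto
qed

end
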